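(* Let $K$ be an algebraically closed field and $m$ a positive integer. For all $A,B\in\mathcal{N}_{3,m}$ we have \[A\le_{\mathrm{deg}} B\iff A\le_{\mathrm{hom}} B.\]
   Context: For positive integers $n\ge 2$ and $m$, $\mathrm{GL}_n(K)$ acts on the space $(K^{n\times n})^m$ of $m$-tuples of $n\times n$ matrices by simultaneous conjugation: $g\cdot(A_1,\dots,A_m)=(gA_1g^{-1},\dots,gA_mg^{-1})$. $\mathcal{O}(A)$ denotes the $\mathrm{GL}_n(K)$-orbit of $A$, and $\overline{\mathcal{O}(A)}$ its Zariski closure in $(K^{n\times n})^m$. The preorder $\le_{\mathrm{deg}}$ on $(K^{n\times n})^m$: $A\le_{\mathrm{deg}}B$ (``$A$ degenerates to $B$'') means $B\in\overline{\mathcal{O}(A)}$. The preorder $\le_{\mathrm{hom}}$ on $(K^{n\times n})^m$: let $R=K\langle x_1,\dots,x_m\rangle$ be the free associative unital $K$-algebra. For a matrix $\varphi=(\varphi_{ij})\in R^{k\times l}$ and $A\in (K^{n\times n})^m$ let $\varphi(A)$ be the $kn\times ln$ matrix over $K$ whose $(i,j)$ block of size $n\times n$ is $\varphi_{ij}(A_1,\dots,A_m)$. Then $A\le_{\mathrm{hom}}B$ means $\mathrm{rk}\,\varphi(A)\ge \mathrm{rk}\,\varphi(B)$ for all $k,l\ge 1$ and all $\varphi\in R^{k\times l}$. The nullcone $\mathcal{N}_{n,m}$ is the set of all $A\in (K^{n\times n})^m$ such that the zero tuple lies in $\overline{\mathcal{O}(A)}$; equivalently, the set of $A=(A_1,\dots,A_m)$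 such that $A_1,\dots,A_m$ generate a nilpotent (non-unital) subalgebra of $K^{n\times n}$. *)

theory Defs
  imports
    "HOL-Library.Poly_Mapping"
    "Jordan_Normal_Form.DL_Rank"
begin

section \<open>Tuples of matrices and simultaneous conjugation\<close>

text \<open>The space of \<open>m\<close>-tuples of \<open>n \<times> n\<close> matrices; a tuple is a list of length \<open>m\<close>,
  with components indexed by \<open>0, \<dots>, m - 1\<close>.\<close>

definition mat_tuples :: "nat \<Rightarrow> nat \<Rightarrow> 'k mat list set" where
  "mat_tuples n m = {As. length As = m \<and> set As \<subseteq> carrier_mat n n}"

definition conj_orbit :: "nat \<Rightarrow> 'k::field mat list \<Rightarrow> 'k mat list set" where
  "conj_orbit n As = {map (\<lambda>X. g * X * h) As | g h.
     g \<in> carrier_mat n n \<and> h \<in> carrier_mat n n \<and> g * h = 1\<^sub>m n \<and> h * g = 1\<^sub>m n}"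


section \<open>Zariski closure\<close>

text \<open>Polynomial functions in the \<open>m n\<^sup>2\<close> matrix entries: the smallest set of functions that
  contains the constants and the coordinates and is closed under sums and products.\<close>

inductive_set poly_funs :: "nat \<Rightarrow> nat \<Rightarrow> ('k::field mat list \<Rightarrow> 'k) set"
  for n m :: nat where
  const: "(\<lambda>As. c) \<in> poly_funs n m"
| coord: "\<lbrakk>r < m; i < n; j < n\<rbrakk> \<Longrightarrow> (\<lambda>As. (As ! r) $$ (i, j)) \<in> poly_funs n m"
| add: "\<lbrakk>f \<in> poly_funs n m; g \<in> poly_funs n m\<rbrakk> \<Longrightarrow> (\<lambda>As. f As + g As) \<in> poly_funs n m"
| mult: "\<lbrakk>f \<in> poly_funs n m; g \<in> poly_funs n m\<rbrakk> \<Longrightarrow> (\<lambda>As. f As * g As) \<in> poly_funs n m"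

definition zariski_closed :: "nat \<Rightarrow> nat \<Rightarrow> 'k::field mat list set \<Rightarrow> bool" where
  "zariski_closed n m Z \<longleftrightarrow>
     (\<exists>P \<subseteq> poly_funs n m. Z = {As \<in> mat_tuples n m. \<forall>f\<in>P. f As = 0})"

definition zariski_closure :: "nat \<Rightarrow> nat \<Rightarrow> 'k::field mat list set \<Rightarrow> 'k mat list set" where
  "zariski_closure n m S = \<Inter>{Z. zariski_closed n m Z \<and> S \<subseteq> Z}"


section \<open>The degeneration preorder and the nullcone\<close>

definition deg_le :: "nat \<Rightarrow> nat \<Rightarrow> 'k::field mat list \<Rightarrow> 'k mat list \<Rightarrow> bool" where
  "deg_le n m A B \<longleftrightarrow> B \<in> zariski_closure n m (conj_orbit n A)"

definition nullcone :: "nat \<Rightarrow> nat \<Rightarrow> 'k::field mat list set" where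
  "nullcone n m = {A \<in> mat_tuples n m.
     replicate m (0\<^sub>m n n) \<in> zariski_closure n m (conj_orbit n A)}"


section \<open>The hom preorder\<close>

text \<open>Elements of the free associative unital algebra on \<open>x\<^sub>0, \<dots>, x\<^bsub>m-1\<^esub>\<close> are finitely supported
  coefficient functions on words; the word \<open>[i\<^sub>1, \<dots>, i\<^sub>s]\<close> stands for the monomial
  \<open>x\<^bsub>i\<^sub>1\<^esub> \<cdots> x\<^bsub>i\<^sub>s\<^esub>\<close>, and the empty word for the unit. Only the evaluation at a tuple of
  matrices is needed here, so the algebra structure itself is not set up.\<close>

definition free_alg :: "nat \<Rightarrow> (nat list \<Rightarrow>\<^sub>0 'k::field) set" where
  "free_alg m = {p. Poly_Mapping.keys p \<subseteq> lists {..<m}}"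

definition eval_word :: "nat \<Rightarrow> 'k::field mat list \<Rightarrow> nat list \<Rightarrow> 'k mat" where
  "eval_word n A w = foldr (\<lambda>i M. (A ! i) * M) w (1\<^sub>m n)"

text \<open>The entrywise form of \<open>\<Sum>\<^sub>w p\<^sub>w A\<^sup>w\<close>: the type of matrices of all sizes has no neutral
  element for addition, so \<open>sum\<close> is not available on it.\<close>

definition eval_free :: "nat \<Rightarrow> 'k::field mat list \<Rightarrow> (nat list \<Rightarrow>\<^sub>0 'k) \<Rightarrow> 'k mat" where
  "eval_free n A p =
     mat n n (\<lambda>ij. \<Sum>w\<in>Poly_Mapping.keys p. Poly_Mapping.lookup p w * eval_word n A w $$ ij)"

definition eval_mat ::
    "nat \<Rightarrow> 'k::field mat list \<Rightarrow> (nat list \<Rightarrow>\<^sub>0 'k) mat \<Rightarrow> 'k mat" where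
  "eval_mat n A \<phi> = mat (dim_row \<phi> * n) (dim_col \<phi> * n)
     (\<lambda>(r, c). eval_free n A (\<phi> $$ (r div n, c div n)) $$ (r mod n, c mod n))"

text \<open>The first argument of \<^const>\<open>vec_space.rank\<close> is the number of rows.\<close>

definition hom_le :: "nat \<Rightarrow> nat \<Rightarrow> 'k::field mat list \<Rightarrow> 'k mat list \<Rightarrow> bool" where
  "hom_le n m A B \<longleftrightarrow>
     (\<forall>k l. \<forall>\<phi> \<in> carrier_mat k l. 1 \<le> k \<and> 1 \<le> l \<and> elements_mat \<phi> \<subseteq> free_alg m \<longrightarrow>
        vec_space.rank (k * n) (eval_mat n A \<phi>) \<ge> vec_space.rank (k * n) (eval_mat n B \<phi>))"

end

theory Submission
  imports Defs
begin

text \<open>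
  Write a strictly upper triangular \<open>3 \<times> 3\<close> matrix as a triple \<open>(a, b, c)\<close>, where \<open>a\<close> is the entry
  in position \<open>(0,1)\<close>, \<open>b\<close> the one in position \<open>(1,2)\<close> and \<open>c\<close> the one in the corner \<open>(0,2)\<close>. A tuple
  in the nullcone is conjugate to a tuple of such matrices (lemma \<open>nullcone_3_triangular\<close>), so it is
  described by three vectors \<open>a, b, c \<in> K\<^sup>m\<close>. Both preorders are invariant under conjugation, and it
  remains to compare them on such triples.

  Degeneration implies the rank inequalities over every field and for matrices of every size. A matrix
  \<open>M\<close> has rank at least \<open>r\<close> iff \<open>det (P M Q) \<noteq> 0\<close> for some constant matrices \<open>P\<close> and \<open>Q\<close>
  (\<open>le_rank_iff\<close>). With \<open>P\<close> and \<open>Q\<close> chosen for \<open>\<phi>(B)\<close>, the function \<open>X \<mapsto> det (P \<phi>(X) Q)\<close> is a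
  polynomial that does not vanish at \<open>B\<close>, hence does not vanish identically on the orbit of \<open>A\<close>, and the
  rank of \<open>\<phi>\<close> is constant on that orbit (\<open>deg_le_imp_hom_le\<close>).

  For the converse, let \<open>A = (a, b, c)\<close> and \<open>B = (a', b', c')\<close>. A \<open>1 \<times> 1\<close> matrix \<open>\<phi>\<close> shows that every
  noncommutative polynomial that vanishes at \<open>A\<close> vanishes at \<open>B\<close>. The product \<open>A\<^sub>i A\<^sub>j\<close> has the single
  entry \<open>a\<^sub>i b\<^sub>j\<close>, in the corner, so linear forms plus quadratic monomials already carry all the
  information (\<open>hom_le_test_poly\<close>). There are three cases.

  If \<open>a \<noteq> 0\<close> and \<open>b \<noteq> 0\<close>, these relations force either \<open>a' = s a\<close>, \<open>b' = t b\<close> and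
  \<open>c' - s t c \<in> \<langle>a, b\<rangle>\<close>, or that one of \<open>a', b'\<close> is \<open>0\<close> and \<open>a', b', c' \<in> \<langle>a, b\<rangle>\<close>. The family
  \<open>(s a, t b, s t c + x a + y b)\<close> lies in the orbit of \<open>A\<close> for \<open>s, t \<noteq> 0\<close>, hence in its closure for all
  \<open>s, t\<close> (\<open>strict_upper_deg_scale\<close>). It contains \<open>B\<close> in the first alternative. In the second one it
  contains \<open>(0, b, a)\<close> and \<open>(a, 0, b)\<close>, one of which degenerates to \<open>B\<close> by a linear change of its two
  vectors, as in the following cases.

  If \<open>a = 0\<close>, all products vanish at \<open>A\<close>, hence at \<open>B\<close>, so that \<open>a' = 0\<close> or \<open>b' = 0\<close>. Moreover
  \<open>a', b', c' \<in> \<langle>b, c\<rangle>\<close>. When \<open>a' = 0\<close>, the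
  pair \<open>(b', c')\<close> arises from \<open>(b, c)\<close> by a \<open>2 \<times> 2\<close> matrix, which is a limit of invertible ones
  (\<open>strict_upper_deg_last_column\<close>). When \<open>b' = 0\<close>, polynomials alone cannot tell a tuple concentrated in
  the first row from one concentrated in the last column; the \<open>2 \<times> 1\<close> matrices \<open>\<phi> = (x\<^sub>p, x\<^sub>q)\<^sup>T\<close> can. They
  have rank at most 1 at \<open>A\<close>, which makes \<open>a'\<close> and \<open>c'\<close> proportional (\<open>hom_le_column_test\<close>), and then
  \<open>B\<close> is again a degeneration. The case \<open>b = 0\<close> is dual, with \<open>1 \<times> 2\<close> matrices.
\<close>

section \<open>Rank and minors\<close>

lemma mat_mult_zero_vec:
  fixes M :: "'k::semiring_0 mat"
  shows "M \<in> carrier_mat k l \<Longrightarrow> M *\<^sub>v 0\<^sub>v l = 0\<^sub>v k"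
  by (intro eq_vecI) auto

text \<open>Padding with zero rows gives a square matrix whose last row is \<open>0\<close>; it is singular, and its
  kernel is that of the original matrix.\<close>
lemma wide_matrix_kernel:
  fixes C :: "'k::field mat"
  assumes C: "C \<in> carrier_mat s r" and "s < r"
  obtains v where "v \<in> carrier_vec r" "v \<noteq> 0\<^sub>v r" "C *\<^sub>v v = 0\<^sub>v s"
proof -
  define D where "D = mat r r (\<lambda>(i,j). if i < s then C $$ (i,j) else 0)"
  have D: "D \<in> carrier_mat r r" by (simp add: D_def)
  have "D\<^sup>T *\<^sub>v unit_vec r (r - 1) = 0\<^sub>v r"
    using \<open>s < r\<close> by (intro eq_vecI) (auto simp: D_def)
  moreover have "unit_vec r (r - 1) \<noteq> (0\<^sub>v r :: 'k vec)" using \<open>s < r\<close> by simp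
  ultimately have "det D\<^sup>T = 0"
    using det_0_iff_vec_prod_zero_field[of "D\<^sup>T" r] D by (metis transpose_carrier_mat unit_vec_carrier)
  then have "det D = 0" using det_transpose[OF D] by simp
  then obtain v where v: "v \<in> carrier_vec r" "v \<noteq> 0\<^sub>v r" "D *\<^sub>v v = 0\<^sub>v r"
    using det_0_iff_vec_prod_zero_field[OF D] by auto
  have "C *\<^sub>v v = 0\<^sub>v s"
  proof (rule eq_vecI)
    fix i assume i: "i < dim_vec (0\<^sub>v s :: 'k vec)"
    have "(D *\<^sub>v v) $ i = 0" using v(3) i \<open>s < r\<close> by simp
    moreover have "row D i = row C i" using i C \<open>s < r\<close> by (intro eq_vecI) (auto simp: D_def)
    ultimately show "(C *\<^sub>v v) $ i = 0\<^sub>v s $ i" using i C D \<open>s < r\<close> by simp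
  qed (use C in auto)
  with v that show thesis by blast
qed

text \<open>If every unit vector were a value of \<open>N\<close>, then \<open>N\<close> would have a right inverse \<open>V\<close>, which is a wide
  matrix and so cannot be injective.\<close>
lemma tall_matrix_not_onto:
  fixes N :: "'k::field mat"
  assumes N: "N \<in> carrier_mat n r" and "r < n"
  obtains w where "w \<in> carrier_vec n" "\<And>v. v \<in> carrier_vec r \<Longrightarrow> N *\<^sub>v v \<noteq> w"
proof (rule ccontr)
  assume "\<not> thesis"
  with that have "\<forall>w \<in> carrier_vec n. \<exists>v \<in> carrier_vec r. N *\<^sub>v v = w" by blast
  then obtain f where f: "\<And>w. w \<in> carrier_vec n \<Longrightarrow> f w \<in> carrier_vec r \<and> N *\<^sub>v f w = w" by metis
  define V where "V = mat_of_cols r (map (\<lambda>i. f (unit_vec n i)) [0..<n])"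
  have V: "V \<in> carrier_mat r n"
    using mat_of_cols_carrier(1)[of r "map (\<lambda>i. f (unit_vec n i)) [0..<n]"] by (simp add: V_def)
  have NV: "N * V = 1\<^sub>m n"
  proof (rule mat_col_eqI)
    fix j assume "j < dim_col (1\<^sub>m n :: 'k mat)"
    then have j: "j < n" by simp
    then have "col V j = f (unit_vec n j)" using f by (simp add: V_def)
    then have "col (N * V) j = N *\<^sub>v f (unit_vec n j)" using col_mult2[OF N V j] by simp
    then show "col (N * V) j = col (1\<^sub>m n) j" using f j by simp
  qed (use N V in auto)
  obtain v where v: "v \<in> carrier_vec n" "v \<noteq> 0\<^sub>v n" "V *\<^sub>v v = 0\<^sub>v r"
    using wide_matrix_kernel[OF V \<open>r < n\<close>] .
  have "v = (N * V) *\<^sub>v v" using NV v by simp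
  also have "\<dots> = N *\<^sub>v (V *\<^sub>v v)" using N V v by simp
  also have "\<dots> = 0\<^sub>v n" unfolding v(3) using N by auto
  finally show False using v by simp
qed

text \<open>Columns from outside the image are added until the matrix is square and hence invertible; the
  first \<open>r\<close> rows of its inverse are the left inverse.\<close>
lemma injective_matrix_left_inverse:
  fixes N :: "'k::field mat"
  assumes "N \<in> carrier_mat n r"
    and "\<And>v. v \<in> carrier_vec r \<Longrightarrow> N *\<^sub>v v = 0\<^sub>v n \<Longrightarrow> v = 0\<^sub>v r"
  shows "\<exists>P \<in> carrier_mat r n. P * N = 1\<^sub>m r"
  using assms
proof (induction "n - r" arbitrary: r N)
  case 0
  note N = 0(2) and inj = 0(3)
  have "\<not> n < r" using wide_matrix_kernel[OF N] inj by metis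
  then have "r = n" using 0(1) by simp
  have "det N \<noteq> 0" using det_0_iff_vec_prod_zero_field[of N n] N inj \<open>r = n\<close> by blast
  then show ?case using det_non_zero_imp_unit[of N n "()"] N \<open>r = n\<close>
    by (auto simp: Units_def ring_mat_def)
next
  case (Suc d)
  note N = Suc(3) and inj = Suc(4)
  have "r < n" using Suc(2) by simp
  obtain w where w: "w \<in> carrier_vec n" "\<And>v. v \<in> carrier_vec r \<Longrightarrow> N *\<^sub>v v \<noteq> w"
    using tall_matrix_not_onto[OF N \<open>r < n\<close>] by metis
  define N' where "N' = mat n (Suc r) (\<lambda>(i,j). if j < r then N $$ (i,j) else w $ i)"
  have N': "N' \<in> carrier_mat n (Suc r)" by (simp add: N'_def)
  have N'v: "N' *\<^sub>v v = N *\<^sub>v vec r (\<lambda>j. v $ j) + v $ r \<cdot>\<^sub>v w" if "v \<in> carrier_vec (Suc r)" for v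
    using that N w by (intro eq_vecI) (auto simp: N'_def scalar_prod_def mult.commute)
  have inj': "v = 0\<^sub>v (Suc r)" if v: "v \<in> carrier_vec (Suc r)" and z: "N' *\<^sub>v v = 0\<^sub>v n" for v
  proof -
    define v' where "v' = vec r (\<lambda>j. v $ j)"
    have v': "v' \<in> carrier_vec r" by (simp add: v'_def)
    have e: "N *\<^sub>v v' + v $ r \<cdot>\<^sub>v w = 0\<^sub>v n" using N'v[OF v] z by (simp add: v'_def)
    have ei: "(N *\<^sub>v v') $ i + v $ r * w $ i = 0" if "i < n" for i
      using arg_cong[OF e, of "\<lambda>x. x $ i"] that w N by simp
    have r0: "v $ r = 0"
    proof (rule ccontr)
      assume nz: "v $ r \<noteq> 0"
      have "N *\<^sub>v ((- 1 / v $ r) \<cdot>\<^sub>v v') = w"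
      proof (rule eq_vecI)
        fix i assume "i < dim_vec w"
        then have i: "i < n" using w by simp
        have "(N *\<^sub>v ((- 1 / v $ r) \<cdot>\<^sub>v v')) $ i = (- 1 / v $ r) * (N *\<^sub>v v') $ i"
          using mult_mat_vec[OF N v'] i N by simp
        also have "(N *\<^sub>v v') $ i = - (v $ r * w $ i)" using ei[OF i] by (simp add: eq_neg_iff_add_eq_0)
        finally show "(N *\<^sub>v ((- 1 / v $ r) \<cdot>\<^sub>v v')) $ i = w $ i" using nz by simp
      qed (use N w in auto)
      then show False using w(2)[of "(- 1 / v $ r) \<cdot>\<^sub>v v'"] v' by simp
    qed
    have "N *\<^sub>v v' = 0\<^sub>v n" using ei r0 N by (intro eq_vecI) auto
    then have "v' = 0\<^sub>v r" using inj v' by blast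
    then have "v $ j = 0" if "j < r" for j
      using arg_cong[of v' "0\<^sub>v r" "\<lambda>x. x $ j"] that index_vec[of j r "\<lambda>j. v $ j"]
      unfolding v'_def by (simp del: index_vec)
    then show ?thesis using r0 v by (intro eq_vecI) (auto simp: less_Suc_eq)
  qed
  have "\<exists>P \<in> carrier_mat (Suc r) n. P * N' = 1\<^sub>m (Suc r)"
    using Suc(1)[OF _ N' inj'] Suc(2) by simp
  then obtain P where P: "P \<in> carrier_mat (Suc r) n" "P * N' = 1\<^sub>m (Suc r)" by blast
  define Q where "Q = mat r n (\<lambda>(i,j). P $$ (i,j))"
  have "Q * N = 1\<^sub>m r"
  proof (rule eq_matI)
    fix i j assume "i < dim_row (1\<^sub>m r :: 'k mat)" "j < dim_col (1\<^sub>m r :: 'k mat)"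
    then have ij: "i < r" "j < r" by auto
    have "(Q * N) $$ (i,j) = (P * N') $$ (i,j)"
      using ij P(1) N by (simp add: scalar_prod_def Q_def N'_def)
    then show "(Q * N) $$ (i,j) = 1\<^sub>m r $$ (i,j)" using P ij by simp
  qed (use N in \<open>auto simp: Q_def\<close>)
  then show ?case by (intro bexI[of _ Q]) (auto simp: Q_def)
qed

text \<open>The columns of \<open>N\<close> form a basis of the column space chosen among the columns of \<open>M\<close>. Then \<open>Q\<close>
  selects these columns, and \<open>C\<close> expresses all columns of \<open>M\<close> in the basis.\<close>
lemma rank_factorization:
  fixes M :: "'k::field mat"
  assumes M: "M \<in> carrier_mat n nc"
  obtains N C Q :: "'k mat" where
    "N \<in> carrier_mat n (vec_space.rank n M)" "C \<in> carrier_mat (vec_space.rank n M) nc"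
    "Q \<in> carrier_mat nc (vec_space.rank n M)" "M = N * C" "N = M * Q"
    "\<And>v. v \<in> carrier_vec (vec_space.rank n M) \<Longrightarrow> N *\<^sub>v v = 0\<^sub>v n \<Longrightarrow> v = 0\<^sub>v (vec_space.rank n M)"
proof -
  interpret vs: vec_space "TYPE('k)" n .
  obtain S where max: "maximal S (\<lambda>T. T \<subseteq> set (cols M) \<and> vs.lin_indpt T)"
    using maximal_exists_superset[of "set (cols M)" "\<lambda>T. T \<subseteq> set (cols M) \<and> vs.lin_indpt T" "{}"]
      vs.finite_lin_indpt2 by auto
  have S: "S \<subseteq> set (cols M)" "vs.lin_indpt S" using max by (auto simp: maximal_def)
  have colsM: "set (cols M) \<subseteq> carrier_vec n" using M cols_dim by blast
  have Sc: "S \<subseteq> carrier_vec n" using S colsM by blast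
  have finS: "finite S" using S finite_subset by blast
  obtain cs where cs: "set cs = S" "distinct cs" using finite_distinct_list[OF finS] by auto
  define s where "s = vs.rank M"
  have len: "length cs = s"
    using vs.rank_card_indpt[OF M max] distinct_card[OF cs(2)] cs(1) by (simp add: s_def)
  define N where "N = mat_of_cols n cs"
  have N: "N \<in> carrier_mat n s" using mat_of_cols_carrier(1)[of n cs] by (simp add: N_def len)
  have colsN: "cols N = cs" unfolding N_def using cols_mat_of_cols Sc cs by blast
  have inj: "v = 0\<^sub>v s" if "v \<in> carrier_vec s" "N *\<^sub>v v = 0\<^sub>v n" for v
    using vs.lin_depI[OF N that(1) _ that(2)] colsN cs S by auto
  have inspan: "v \<in> vs.span S" if "v \<in> set (cols M)" for v
  proof (cases "v \<in> S")
    case True then show ?thesis using vs.span_mem[OF Sc] by blast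
  next
    case False
    have "\<not> vs.lin_indpt (insert v S)"
      using max S that False by (auto simp: maximal_def)
    then show ?thesis using vs.lin_dep_iff_in_span[OF Sc S(2) _ False] that colsM by auto
  qed
  have "\<forall>j<nc. \<exists>x \<in> carrier_vec s. N *\<^sub>v x = col M j"
  proof (intro allI impI)
    fix j assume j: "j < nc"
    then have "col M j \<in> set (cols M)" using M by (auto simp: cols_def)
    then have "col M j \<in> vs.col_space N" using inspan by (simp add: vs.col_space_def colsN cs)
    then show "\<exists>x \<in> carrier_vec s. N *\<^sub>v x = col M j"
      using vs.col_space_eq[of N s] N by auto
  qed
  then obtain x where x: "\<And>j. j < nc \<Longrightarrow> x j \<in> carrier_vec s \<and> N *\<^sub>v x j = col M j" by metis
  define C where "C = mat_of_cols s (map x [0..<nc])"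
  have C: "C \<in> carrier_mat s nc" using mat_of_cols_carrier(1)[of s "map x [0..<nc]"] by (simp add: C_def)
  have MNC: "M = N * C"
  proof (rule mat_col_eqI)
    fix j assume "j < dim_col (N * C)"
    then have j: "j < nc" using C by simp
    have "col C j = x j" using j x by (simp add: C_def)
    then show "col M j = col (N * C) j" using col_mult2[OF N C j] x j by simp
  qed (use M N C in auto)
  have "\<forall>j<s. \<exists>i<nc. cs ! j = col M i"
  proof (intro allI impI)
    fix j assume "j < s"
    then have "cs ! j \<in> set (cols M)" using S cs len nth_mem by blast
    then show "\<exists>i<nc. cs ! j = col M i" using M by (auto simp: cols_def)
  qed
  then obtain k where k: "\<And>j. j < s \<Longrightarrow> k j < nc \<and> cs ! j = col M (k j)" by metis
  define Q :: "'k mat" where "Q = mat_of_cols nc (map (\<lambda>j. unit_vec nc (k j)) [0..<s])"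
  have Q: "Q \<in> carrier_mat nc s"
    using mat_of_cols_carrier(1)[of nc "map (\<lambda>j. unit_vec nc (k j)) [0..<s]"] by (simp add: Q_def)
  have NMQ: "N = M * Q"
  proof (rule mat_col_eqI)
    fix j assume "j < dim_col (M * Q)"
    then have j: "j < s" using Q by simp
    have "col Q j = unit_vec nc (k j)" using j by (simp add: Q_def)
    then have "col (M * Q) j = M *\<^sub>v unit_vec nc (k j)" using col_mult2[OF M Q j] by simp
    also have "\<dots> = col M (k j)" using M k[OF j] by (intro eq_vecI) auto
    also have "\<dots> = col N j" using k[OF j] colsN j N cols_nth by (metis carrier_matD(2))
    finally show "col N j = col (M * Q) j" by simp
  qed (use M N Q in auto)
  show thesis using that[folded s_def, OF N C Q MNC NMQ inj] .
qed

text \<open>This form of the rank is open in \<open>M\<close> in a visible way, because for fixed \<open>P\<close> and \<open>Q\<close> the determinant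
  is a polynomial in the entries of \<open>M\<close>. For the forward direction a left inverse of \<open>N\<close> gives
  \<open>P M Q = 1\<close>, which is then truncated to size \<open>r\<close>. For the other one, \<open>P M Q = (P N)(C Q)\<close> factors
  through a space of dimension \<open>rank M\<close>.\<close>
lemma le_rank_iff:
  fixes M :: "'k::field mat"
  assumes M: "M \<in> carrier_mat n nc"
  shows "r \<le> vec_space.rank n M \<longleftrightarrow>
    (\<exists>P \<in> carrier_mat r n. \<exists>Q \<in> carrier_mat nc r. det (P * M * Q) \<noteq> 0)"
proof -
  define s where "s = vec_space.rank n M"
  obtain N C Q :: "'k mat" where N: "N \<in> carrier_mat n s" and C: "C \<in> carrier_mat s nc"
    and Q: "Q \<in> carrier_mat nc s" and MNC: "M = N * C" and NMQ: "N = M * Q"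
    and inj: "\<And>v. v \<in> carrier_vec s \<Longrightarrow> N *\<^sub>v v = 0\<^sub>v n \<Longrightarrow> v = 0\<^sub>v s"
    using rank_factorization[OF M] unfolding s_def by metis
  show ?thesis unfolding s_def[symmetric]
  proof
    assume "r \<le> s"
    obtain P where P: "P \<in> carrier_mat s n" and PN: "P * N = 1\<^sub>m s"
      using injective_matrix_left_inverse[OF N inj] by auto
    define P' where "P' = mat r n (\<lambda>(i,j). P $$ (i,j))"
    define Q' where "Q' = mat nc r (\<lambda>(i,j). Q $$ (i,j))"
    have P': "P' \<in> carrier_mat r n" and Q': "Q' \<in> carrier_mat nc r" by (auto simp: P'_def Q'_def)
    have "P' * M * Q' = 1\<^sub>m r"
    proof (rule eq_matI)
      fix i j assume "i < dim_row (1\<^sub>m r :: 'k mat)" "j < dim_col (1\<^sub>m r :: 'k mat)"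
      then have ij: "i < r" "j < r" by auto
      have "row P' i = row P i"
        using ij \<open>r \<le> s\<close> P by (intro eq_vecI) (auto simp: P'_def)
      then have "row (P' * M) i = row (P * M) i"
        using ij \<open>r \<le> s\<close> P P' M by (intro eq_vecI) auto
      moreover have "col Q' j = col Q j"
        using ij \<open>r \<le> s\<close> Q by (intro eq_vecI) (auto simp: Q'_def)
      ultimately have "(P' * M * Q') $$ (i,j) = (P * M * Q) $$ (i,j)"
        using ij \<open>r \<le> s\<close> P Q P' Q' M by (simp del: row_mult assoc_mult_mat)
      also have "P * M * Q = 1\<^sub>m s" using PN NMQ assoc_mult_mat[OF P M Q] by simp
      finally show "(P' * M * Q') $$ (i,j) = 1\<^sub>m r $$ (i,j)" using ij \<open>r \<le> s\<close> by simp
    qed (use P' Q' in auto)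
    then have "det (P' * M * Q') \<noteq> 0" by simp
    then show "\<exists>P \<in> carrier_mat r n. \<exists>Q \<in> carrier_mat nc r. det (P * M * Q) \<noteq> 0"
      using P' Q' by blast
  next
    assume "\<exists>P \<in> carrier_mat r n. \<exists>Q \<in> carrier_mat nc r. det (P * M * Q) \<noteq> 0"
    then obtain P' Q' where P': "P' \<in> carrier_mat r n" and Q': "Q' \<in> carrier_mat nc r"
      and d: "det (P' * M * Q') \<noteq> 0" by auto
    show "r \<le> s"
    proof (rule ccontr)
      assume "\<not> r \<le> s"
      then obtain v where v: "v \<in> carrier_vec r" "v \<noteq> 0\<^sub>v r" "(C * Q') *\<^sub>v v = 0\<^sub>v s"
        using wide_matrix_kernel[OF mult_carrier_mat[OF C Q']] by (metis not_le)
      have "P' * M * Q' = (P' * N) * (C * Q')"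
        unfolding MNC using assoc_mult_mat[OF P' N C] assoc_mult_mat[of "P' * N" r s C nc Q' r] P' N C Q'
        by simp
      then have "(P' * M * Q') *\<^sub>v v = (P' * N) *\<^sub>v ((C * Q') *\<^sub>v v)"
        using assoc_mult_mat_vec[of "P' * N" r s "C * Q'" r v] P' N C Q' v(1) by simp
      also have "\<dots> = 0\<^sub>v r" unfolding v(3) by (rule mat_mult_zero_vec[OF mult_carrier_mat[OF P' N]])
      finally have "det (P' * M * Q') = 0"
        using det_0_iff_vec_prod_zero_field[OF mult_carrier_mat[OF mult_carrier_mat[OF P' M] Q']] v(1,2)
        by blast
      with d show False by simp
    qed
  qed
qed

text \<open>The matrices \<open>P\<close> and \<open>Q\<close> select the rows \<open>\<rho> 0, \<dots>, \<rho> (r - 1)\<close> and the columns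
  \<open>\<kappa> 0, \<dots>, \<kappa> (r - 1)\<close>.\<close>
lemma minor_le_rank:
  fixes M :: "'k::field mat"
  assumes M: "M \<in> carrier_mat k l" and \<rho>: "\<And>i. i < r \<Longrightarrow> \<rho> i < k" and \<kappa>: "\<And>j. j < r \<Longrightarrow> \<kappa> j < l"
    and nz: "det (mat r r (\<lambda>(i,j). M $$ (\<rho> i, \<kappa> j))) \<noteq> 0"
  shows "r \<le> vec_space.rank k M"
proof -
  define P :: "'k mat" where "P = mat r k (\<lambda>(i,j). if j = \<rho> i then 1 else 0)"
  define Q :: "'k mat" where "Q = mat l r (\<lambda>(i,j). if i = \<kappa> j then 1 else 0)"
  have P: "P \<in> carrier_mat r k" and Q: "Q \<in> carrier_mat l r" by (auto simp: P_def Q_def)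
  have PM: "(P * M) $$ (i,j) = M $$ (\<rho> i, j)" if "i < r" "j < l" for i j
  proof -
    have "(P * M) $$ (i,j) = (\<Sum>t\<in>{0..<k}. (if t = \<rho> i then 1 else 0) * M $$ (t,j))"
      using M that by (simp add: P_def scalar_prod_def)
    also have "\<dots> = (\<Sum>t\<in>{0..<k}. if t = \<rho> i then M $$ (t,j) else 0)"
      by (intro sum.cong) auto
    finally show ?thesis using \<rho>[OF that(1)] by (simp add: sum.delta)
  qed
  define N where "N = P * M"
  have N: "N \<in> carrier_mat r l" using P M by (simp add: N_def)
  have "N * Q = mat r r (\<lambda>(i,j). M $$ (\<rho> i, \<kappa> j))"
  proof (rule eq_matI)
    fix i j assume "i < dim_row (mat r r (\<lambda>(i,j). M $$ (\<rho> i, \<kappa> j)))" "j < dim_col (mat r r (\<lambda>(i,j). M $$ (\<rho> i, \<kappa> j)))"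
    then have ij: "i < r" "j < r" by auto
    have "(N * Q) $$ (i,j) = (\<Sum>t\<in>{0..<l}. N $$ (i,t) * (if t = \<kappa> j then 1 else 0))"
      using N ij by (simp add: Q_def scalar_prod_def)
    also have "\<dots> = (\<Sum>t\<in>{0..<l}. if t = \<kappa> j then N $$ (i,t) else 0)"
      by (intro sum.cong) auto
    finally show "(N * Q) $$ (i,j) = mat r r (\<lambda>(i,j). M $$ (\<rho> i, \<kappa> j)) $$ (i,j)"
      using \<kappa>[OF ij(2)] ij PM by (simp add: sum.delta N_def)
  qed (use N Q in auto)
  then have "det (P * M * Q) \<noteq> 0" using nz by (simp add: N_def)
  then show ?thesis using le_rank_iff[OF M] P Q by blast
qed

lemma det_2_eq_0:
  fixes M :: "'k::field mat"
  assumes "M \<in> carrier_mat 2 2"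
  shows "det M = 0 \<Longrightarrow> M $$ (0,0) * M $$ (1,1) = M $$ (0,1) * M $$ (1,0)"
proof -
  assume "det M = 0"
  then obtain v where v: "v \<in> carrier_vec 2" "v \<noteq> 0\<^sub>v 2" "M *\<^sub>v v = 0\<^sub>v 2"
    using det_0_iff_vec_prod_zero_field[OF assms] by auto
  have e: "M $$ (i,0) * v $ 0 + M $$ (i,1) * v $ 1 = 0" if "i < 2" for i
    using arg_cong[OF v(3), of "\<lambda>x. x $ i"] that v(1) assms by (simp add: scalar_prod_def numeral_2_eq_2)
  have nz: "v $ 0 \<noteq> 0 \<or> v $ 1 \<noteq> 0"
  proof (rule ccontr)
    assume "\<not> (v $ 0 \<noteq> 0 \<or> v $ 1 \<noteq> 0)"
    then have "v = 0\<^sub>v 2" using v(1) by (intro eq_vecI) (auto simp: numeral_2_eq_2 less_Suc_eq)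
    then show False using v(2) by simp
  qed
  let ?D = "M $$ (0,0) * M $$ (1,1) - M $$ (0,1) * M $$ (1,0)"
  have "?D * v $ 0 = M $$ (1,1) * (M $$ (0,0) * v $ 0 + M $$ (0,1) * v $ 1) - M $$ (0,1) * (M $$ (1,0) * v $ 0 + M $$ (1,1) * v $ 1)"
    by (simp add: algebra_simps)
  moreover have "?D * v $ 1 = M $$ (0,0) * (M $$ (1,0) * v $ 0 + M $$ (1,1) * v $ 1) - M $$ (1,0) * (M $$ (0,0) * v $ 0 + M $$ (0,1) * v $ 1)"
    by (simp add: algebra_simps)
  ultimately have "?D * v $ 0 = 0" "?D * v $ 1 = 0" using e[of 0] e[of 1] by simp_all
  then show ?thesis using nz by auto
qed

lemma minors2_eq_if_rank_le_1:
  fixes M :: "'k::field mat"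
  assumes M: "M \<in> carrier_mat k l" and r: "vec_space.rank k M \<le> 1"
    and ij: "i < k" "i' < k" "j < l" "j' < l"
  shows "M $$ (i,j) * M $$ (i',j') = M $$ (i,j') * M $$ (i',j)"
proof -
  define \<rho> where "\<rho> t = (if t = 0 then i else i')" for t :: nat
  define \<kappa> where "\<kappa> t = (if t = 0 then j else j')" for t :: nat
  let ?N = "mat 2 2 (\<lambda>(s,t). M $$ (\<rho> s, \<kappa> t))"
  have "det ?N = 0"
  proof (rule ccontr)
    assume "det ?N \<noteq> 0"
    then have "2 \<le> vec_space.rank k M" using ij by (intro minor_le_rank[OF M]) (auto simp: \<rho>_def \<kappa>_def)
    with r show False by simp
  qed
  then show ?thesis using det_2_eq_0[of ?N] by (simp add: \<rho>_def \<kappa>_def)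
qed

lemma zero_if_rank_0:
  fixes M :: "'k::field mat"
  assumes M: "M \<in> carrier_mat k l" and r: "vec_space.rank k M = 0"
  shows "M = 0\<^sub>m k l"
proof (rule eq_matI)
  fix i j assume "i < dim_row (0\<^sub>m k l :: 'k mat)" "j < dim_col (0\<^sub>m k l :: 'k mat)"
  then have ij: "i < k" "j < l" by auto
  have "\<not> 1 \<le> vec_space.rank k M" using r by simp
  then have "det (mat 1 1 (\<lambda>(s,t). M $$ (i, j))) = 0"
    using minor_le_rank[OF M, of 1 "\<lambda>_. i" "\<lambda>_. j"] ij by auto
  then show "M $$ (i,j) = 0\<^sub>m k l $$ (i,j)" using ij by (simp add: det_single)
qed (use M in auto)

section \<open>Regular functions and orbit closures\<close>

text \<open>Polynomial functions are functions on all lists of matrices, but a formula such as a determinant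
  agrees with one only on tuples of the right shape. Zariski closures do not see the difference.\<close>
definition regular :: "nat \<Rightarrow> nat \<Rightarrow> ('k::field mat list \<Rightarrow> 'k) \<Rightarrow> bool" where
  "regular n m F \<longleftrightarrow> (\<exists>f \<in> poly_funs n m. \<forall>X \<in> mat_tuples n m. F X = f X)"

lemma regular_poly_fun: "f \<in> poly_funs n m \<Longrightarrow> regular n m f"
  unfolding regular_def by blast

lemma regular_const: "regular n m (\<lambda>X. c)"
  by (intro regular_poly_fun poly_funs.const)

lemma regular_coord:
  "r < m \<Longrightarrow> i < n \<Longrightarrow> j < n \<Longrightarrow> regular n m (\<lambda>X. (X ! r) $$ (i,j))"
  by (intro regular_poly_fun poly_funs.coord)

lemma regular_add: "regular n m F \<Longrightarrow> regular n m G \<Longrightarrow> regular n m (\<lambda>X. F X + G X)"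
  unfolding regular_def by (elim bexE, rule_tac x = "\<lambda>X. f X + fa X" in bexI) (auto intro: poly_funs.add)

lemma regular_mult: "regular n m F \<Longrightarrow> regular n m G \<Longrightarrow> regular n m (\<lambda>X. F X * G X)"
  unfolding regular_def by (elim bexE, rule_tac x = "\<lambda>X. f X * fa X" in bexI) (auto intro: poly_funs.mult)

lemma regular_diff:
  assumes "regular n m F" "regular n m G" shows "regular n m (\<lambda>X. F X - G X)"
  using regular_add[OF assms(1) regular_mult[OF regular_const[of n m "-1"] assms(2)]] by simp

lemma regular_sum:
  "(\<And>x. x \<in> S \<Longrightarrow> regular n m (F x)) \<Longrightarrow> regular n m (\<lambda>X. \<Sum>x\<in>S. F x X)"
  by (induction S rule: infinite_finite_induct) (auto intro: regular_const regular_add)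

lemma regular_prod:
  "(\<And>x. x \<in> S \<Longrightarrow> regular n m (F x)) \<Longrightarrow> regular n m (\<lambda>X. \<Prod>x\<in>S. F x X)"
  by (induction S rule: infinite_finite_induct) (auto intro: regular_const regular_mult)

lemma regular_cong:
  "regular n m F \<Longrightarrow> (\<And>X. X \<in> mat_tuples n m \<Longrightarrow> G X = F X) \<Longrightarrow> regular n m G"
  unfolding regular_def by metis

definition regular_mat :: "nat \<Rightarrow> nat \<Rightarrow> nat \<Rightarrow> nat \<Rightarrow> ('k::field mat list \<Rightarrow> 'k mat) \<Rightarrow> bool" where
  "regular_mat n m p q F \<longleftrightarrow> (\<forall>X \<in> mat_tuples n m. F X \<in> carrier_mat p q) \<and>
     (\<forall>i<p. \<forall>j<q. regular n m (\<lambda>X. F X $$ (i,j)))"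

lemma regular_mat_cong:
  assumes "regular_mat n m p q F" and "\<And>X. X \<in> mat_tuples n m \<Longrightarrow> G X = F X"
  shows "regular_mat n m p q G"
  unfolding regular_mat_def
proof (intro conjI ballI allI impI)
  fix i j assume "i < p" "j < q"
  then have "regular n m (\<lambda>X. F X $$ (i,j))" using assms(1) by (simp add: regular_mat_def)
  then show "regular n m (\<lambda>X. G X $$ (i,j))" by (rule regular_cong) (simp add: assms(2))
qed (use assms in \<open>simp add: regular_mat_def\<close>)

lemma regular_mat_const: "M \<in> carrier_mat p q \<Longrightarrow> regular_mat n m p q (\<lambda>X. M)"
  by (simp add: regular_mat_def regular_const)

lemma regular_mat_coord: "r < m \<Longrightarrow> regular_mat n m n n (\<lambda>X. X ! r)"
  by (auto simp: regular_mat_def regular_coord mat_tuples_def)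

lemma regular_mat_mult:
  assumes "regular_mat n m p q F" "regular_mat n m q r G"
  shows "regular_mat n m p r (\<lambda>X. F X * G X)"
  unfolding regular_mat_def
proof (intro conjI ballI allI impI)
  fix i j assume "i < p" "j < r"
  have "regular n m (\<lambda>X. \<Sum>l\<in>{0..<q}. F X $$ (i,l) * G X $$ (l,j))"
    using assms \<open>i < p\<close> \<open>j < r\<close> by (auto simp: regular_mat_def intro!: regular_sum regular_mult)
  then show "regular n m (\<lambda>X. (F X * G X) $$ (i,j))"
  proof (rule regular_cong)
    fix X :: "'a mat list" assume "X \<in> mat_tuples n m"
    then have "F X \<in> carrier_mat p q" "G X \<in> carrier_mat q r" using assms by (auto simp: regular_mat_def)
    then show "(F X * G X) $$ (i,j) = (\<Sum>l\<in>{0..<q}. F X $$ (i,l) * G X $$ (l,j))"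
      using \<open>i < p\<close> \<open>j < r\<close> by (simp add: scalar_prod_def)
  qed
qed (use assms in \<open>auto simp: regular_mat_def\<close>)

lemma regular_mat_diff:
  assumes "regular_mat n m p q F" "regular_mat n m p q G"
  shows "regular_mat n m p q (\<lambda>X. F X - G X)"
  unfolding regular_mat_def
proof (intro conjI ballI allI impI)
  fix i j assume "i < p" "j < q"
  then have "regular n m (\<lambda>X. F X $$ (i,j) - G X $$ (i,j))"
    using assms by (auto simp: regular_mat_def intro!: regular_diff)
  then show "regular n m (\<lambda>X. (F X - G X) $$ (i,j))"
    by (rule regular_cong) (use assms \<open>i < p\<close> \<open>j < q\<close> in \<open>auto simp: regular_mat_def\<close>)
qed (use assms in \<open>auto simp: regular_mat_def intro!: minus_carrier_mat\<close>)

lemma regular_det: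
  assumes "regular_mat n m p p F" shows "regular n m (\<lambda>X. det (F X))"
proof (rule regular_cong)
  show "regular n m (\<lambda>X. \<Sum>\<pi>\<in>{\<pi>. \<pi> permutes {0..<p}}. signof \<pi> * (\<Prod>i\<in>{0..<p}. F X $$ (i, \<pi> i)))"
    using assms permutes_in_image
    by (fastforce simp: regular_mat_def intro!: regular_sum regular_mult regular_const regular_prod)
qed (use assms in \<open>auto simp: regular_mat_def det_def'\<close>)

lemma regular_comp_poly_fun:
  assumes f: "f \<in> poly_funs n m"
    and G: "\<And>X. X \<in> mat_tuples n m \<Longrightarrow> G X \<in> mat_tuples n m"
    and reg: "\<And>r. r < m \<Longrightarrow> regular_mat n m n n (\<lambda>X. G X ! r)"
  shows "regular n m (\<lambda>X. f (G X))"
  using f by induction (use reg in \<open>auto simp: regular_mat_def intro: regular_const regular_add regular_mult\<close>)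

definition inverse_pair :: "nat \<Rightarrow> 'k::field mat \<Rightarrow> 'k mat \<Rightarrow> bool" where
  "inverse_pair n g h \<longleftrightarrow> g \<in> carrier_mat n n \<and> h \<in> carrier_mat n n \<and> g * h = 1\<^sub>m n \<and> h * g = 1\<^sub>m n"

lemma inverse_pair_sym: "inverse_pair n g h \<Longrightarrow> inverse_pair n h g"
  by (auto simp: inverse_pair_def)

lemma inverse_pair_mult:
  assumes "inverse_pair n g h" "inverse_pair n g' h'"
  shows "inverse_pair n (g * g') (h' * h)"
proof -
  have c: "g \<in> carrier_mat n n" "h \<in> carrier_mat n n" "g' \<in> carrier_mat n n" "h' \<in> carrier_mat n n"
    and e: "g * h = 1\<^sub>m n" "h * g = 1\<^sub>m n" "g' * h' = 1\<^sub>m n" "h' * g' = 1\<^sub>m n"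
    using assms by (auto simp: inverse_pair_def)
  have "g * g' * (h' * h) = g * (g' * h') * h" using c by (simp add: assoc_mult_mat[of _ n n _ n _ n])
  moreover have "h' * h * (g * g') = h' * (h * g) * g'" using c by (simp add: assoc_mult_mat[of _ n n _ n _ n])
  ultimately show ?thesis using c e by (simp add: inverse_pair_def)
qed

lemma inverse_pair_of_det:
  assumes "g \<in> carrier_mat n n" "det g \<noteq> 0"
  obtains h where "inverse_pair n g h"
  using det_non_zero_imp_unit[OF assms, of "()"] assms that
  by (auto simp: Units_def ring_mat_def inverse_pair_def)

definition conj_tuple :: "'k::field mat \<Rightarrow> 'k mat \<Rightarrow> 'k mat list \<Rightarrow> 'k mat list" where
  "conj_tuple g h A = map (\<lambda>X. g * X * h) A"

lemma conj_orbit_eq: "conj_orbit n A = {conj_tuple g h A | g h. inverse_pair n g h}"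
  by (simp add: conj_orbit_def conj_tuple_def inverse_pair_def)

lemma conj_tuple_in_mat_tuples:
  "inverse_pair n g h \<Longrightarrow> A \<in> mat_tuples n m \<Longrightarrow> conj_tuple g h A \<in> mat_tuples n m"
  by (auto simp: inverse_pair_def mat_tuples_def conj_tuple_def)

lemma conj_orbit_subset: "A \<in> mat_tuples n m \<Longrightarrow> conj_orbit n A \<subseteq> mat_tuples n m"
  using conj_tuple_in_mat_tuples by (fastforce simp: conj_orbit_eq)

lemma conj_tuple_conj_tuple:
  assumes "inverse_pair n g h" "inverse_pair n g' h'" "A \<in> mat_tuples n m"
  shows "conj_tuple g h (conj_tuple g' h' A) = conj_tuple (g * g') (h' * h) A"
proof -
  have "g * (g' * X * h') * h = g * g' * X * (h' * h)" if "X \<in> set A" for X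
  proof -
    have c: "g \<in> carrier_mat n n" "h \<in> carrier_mat n n" "g' \<in> carrier_mat n n" "h' \<in> carrier_mat n n"
      "X \<in> carrier_mat n n" using assms that by (auto simp: inverse_pair_def mat_tuples_def)
    then show ?thesis by (simp add: assoc_mult_mat[of _ n n _ n _ n])
  qed
  then show ?thesis by (simp add: conj_tuple_def)
qed

lemma conj_tuple_one: "A \<in> mat_tuples n m \<Longrightarrow> conj_tuple (1\<^sub>m n) (1\<^sub>m n) A = A"
  unfolding conj_tuple_def by (rule map_idI) (auto simp: mat_tuples_def)

lemma conj_tuple_inverse:
  assumes "inverse_pair n g h" "A \<in> mat_tuples n m"
  shows "conj_tuple h g (conj_tuple g h A) = A"
  using conj_tuple_conj_tuple[OF inverse_pair_sym[OF assms(1)] assms] conj_tuple_one[OF assms(2)] assms(1)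
  by (simp add: inverse_pair_def)

lemma conj_orbit_conj_tuple_subset:
  assumes "inverse_pair n g h" "A \<in> mat_tuples n m"
  shows "conj_orbit n (conj_tuple g h A) \<subseteq> conj_orbit n A"
proof
  fix X assume "X \<in> conj_orbit n (conj_tuple g h A)"
  then obtain g' h' where p: "inverse_pair n g' h'" "X = conj_tuple g' h' (conj_tuple g h A)"
    unfolding conj_orbit_eq by blast
  then have "X = conj_tuple (g' * g) (h * h') A" using conj_tuple_conj_tuple assms by blast
  then show "X \<in> conj_orbit n A" unfolding conj_orbit_eq using inverse_pair_mult[OF p(1) assms(1)] by blast
qed

lemma conj_orbit_conj_tuple:
  assumes "inverse_pair n g h" "A \<in> mat_tuples n m"
  shows "conj_orbit n (conj_tuple g h A) = conj_orbit n A"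
  using conj_orbit_conj_tuple_subset[OF assms]
    conj_orbit_conj_tuple_subset[OF inverse_pair_sym[OF assms(1)] conj_tuple_in_mat_tuples[OF assms]]
  unfolding conj_tuple_inverse[OF assms] by (rule equalityI)

lemma self_in_conj_orbit: "A \<in> mat_tuples n m \<Longrightarrow> A \<in> conj_orbit n A"
  unfolding conj_orbit_eq using conj_tuple_one[of A n m]
  by (intro CollectI exI[of _ "1\<^sub>m n"]) (auto simp: inverse_pair_def)

text \<open>The common zero set of all polynomial functions that vanish on the orbit is closed, and every closed
  set that contains the orbit contains it.\<close>
lemma deg_le_iff:
  assumes A: "A \<in> mat_tuples n m"
  shows "deg_le n m A B \<longleftrightarrow> B \<in> mat_tuples n m \<and>
    (\<forall>F. regular n m F \<longrightarrow> (\<forall>X \<in> conj_orbit n A. F X = 0) \<longrightarrow> F B = 0)"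
proof (intro iffI conjI allI impI)
  assume d: "deg_le n m A B"
  define P where "P = {f \<in> poly_funs n m. \<forall>X \<in> conj_orbit n A. f X = 0}"
  define Z where "Z = {X \<in> mat_tuples n m. \<forall>f\<in>P. f X = 0}"
  have "P \<subseteq> poly_funs n m" by (auto simp: P_def)
  then have "zariski_closed n m Z" unfolding zariski_closed_def Z_def by blast
  moreover have "conj_orbit n A \<subseteq> Z"
  proof
    fix X assume "X \<in> conj_orbit n A"
    then show "X \<in> Z" using subsetD[OF conj_orbit_subset[OF A]] by (simp add: Z_def P_def)
  qed
  ultimately have BZ: "B \<in> Z" using d by (simp add: deg_le_def zariski_closure_def)
  then show "B \<in> mat_tuples n m" by (simp add: Z_def)
  fix F assume F: "regular n m F" and v: "\<forall>X \<in> conj_orbit n A. F X = 0"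
  obtain f where f: "f \<in> poly_funs n m" "\<And>X. X \<in> mat_tuples n m \<Longrightarrow> F X = f X"
    using F unfolding regular_def by blast
  have "f X = 0" if "X \<in> conj_orbit n A" for X
    using v that f(2)[OF subsetD[OF conj_orbit_subset[OF A] that]] by simp
  then have "f \<in> P" using f(1) by (simp add: P_def)
  then show "F B = 0" using BZ f(2)[of B] by (simp add: Z_def)
next
  assume r: "B \<in> mat_tuples n m \<and>
    (\<forall>F. regular n m F \<longrightarrow> (\<forall>X \<in> conj_orbit n A. F X = 0) \<longrightarrow> F B = 0)"
  have "B \<in> Z" if Z: "zariski_closed n m Z" and s: "conj_orbit n A \<subseteq> Z" for Z
  proof -
    obtain P where P: "P \<subseteq> poly_funs n m" "Z = {X \<in> mat_tuples n m. \<forall>f\<in>P. f X = 0}"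
      using Z unfolding zariski_closed_def by blast
    have "f B = 0" if "f \<in> P" for f
    proof -
      have "\<forall>X \<in> conj_orbit n A. f X = 0" using s that unfolding P(2) by blast
      then show ?thesis using r regular_poly_fun[OF subsetD[OF P(1) that]] by blast
    qed
    then show ?thesis using r unfolding P(2) by simp
  qed
  then show "deg_le n m A B" by (simp add: deg_le_def zariski_closure_def)
qed

text \<open>If \<open>f\<close> vanishes on the orbit of \<open>A\<close>, then so does the polynomial function \<open>f \<circ> conj_tuple g h\<close>. Hence
  orbit closures are stable under conjugation, which makes degeneration transitive.\<close>
lemma deg_le_conj_tuple_right:
  assumes A: "A \<in> mat_tuples n m" and d: "deg_le n m A B" and p: "inverse_pair n g h"
  shows "deg_le n m A (conj_tuple g h B)"
  unfolding deg_le_iff[OF A]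
proof (intro conjI allI impI)
  have B: "B \<in> mat_tuples n m" using d by (simp add: deg_le_iff[OF A])
  then show "conj_tuple g h B \<in> mat_tuples n m" by (rule conj_tuple_in_mat_tuples[OF p])
  fix F assume F: "regular n m F" and v: "\<forall>X \<in> conj_orbit n A. F X = 0"
  obtain f where f: "f \<in> poly_funs n m" "\<And>X. X \<in> mat_tuples n m \<Longrightarrow> F X = f X"
    using F unfolding regular_def by blast
  have "regular n m (\<lambda>X. f (conj_tuple g h X))"
  proof (rule regular_comp_poly_fun[OF f(1) conj_tuple_in_mat_tuples[OF p]])
    fix r assume r: "r < m"
    have "regular_mat n m n n (\<lambda>X. g * (X ! r) * h)"
      using p r by (auto simp: inverse_pair_def intro!: regular_mat_mult regular_mat_const regular_mat_coord)
    moreover have "conj_tuple g h X ! r = g * (X ! r) * h" if "X \<in> mat_tuples n m" for X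
      using that r by (auto simp: conj_tuple_def mat_tuples_def)
    ultimately show "regular_mat n m n n (\<lambda>X. conj_tuple g h X ! r)"
      by (rule regular_mat_cong)
  qed
  moreover have "\<forall>X \<in> conj_orbit n A. f (conj_tuple g h X) = 0"
  proof
    fix X assume X: "X \<in> conj_orbit n A"
    then have "X \<in> mat_tuples n m" using conj_orbit_subset[OF A] by blast
    moreover obtain g' h' where "inverse_pair n g' h'" "X = conj_tuple g' h' A"
      using X by (auto simp: conj_orbit_eq)
    ultimately have o: "conj_tuple g h X \<in> conj_orbit n A"
      using conj_tuple_conj_tuple[OF p _ A] inverse_pair_mult[OF p] unfolding conj_orbit_eq by blast
    then show "f (conj_tuple g h X) = 0" using v f(2)[OF subsetD[OF conj_orbit_subset[OF A] o]] by simp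
  qed
  ultimately have "f (conj_tuple g h B) = 0" using d unfolding deg_le_iff[OF A] by blast
  then show "F (conj_tuple g h B) = 0" using f(2) conj_tuple_in_mat_tuples[OF p B] by simp
qed

lemma deg_le_trans:
  assumes A: "A \<in> mat_tuples n m" and AB: "deg_le n m A B" and BC: "deg_le n m B C"
  shows "deg_le n m A C"
proof -
  have B: "B \<in> mat_tuples n m" using AB by (simp add: deg_le_iff[OF A])
  have "F X = 0" if "regular n m F" "\<forall>X \<in> conj_orbit n A. F X = 0" "X \<in> conj_orbit n B" for F X
    using that deg_le_conj_tuple_right[OF A AB] unfolding deg_le_iff[OF A] conj_orbit_eq by blast
  then show ?thesis using BC unfolding deg_le_iff[OF A] deg_le_iff[OF B] by blast
qed

lemma deg_le_orbit: "A \<in> mat_tuples n m \<Longrightarrow> X \<in> conj_orbit n A \<Longrightarrow> deg_le n m A X"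
  using conj_orbit_subset by (auto simp: deg_le_iff)

lemma deg_le_conj_tuple:
  assumes "A \<in> mat_tuples n m" "inverse_pair n g h"
  shows "deg_le n m A (conj_tuple g h A)" "deg_le n m (conj_tuple g h A) A"
proof -
  show "deg_le n m A (conj_tuple g h A)"
    using assms by (intro deg_le_orbit) (auto simp: conj_orbit_eq)
  show "deg_le n m (conj_tuple g h A) A"
    using deg_le_orbit[OF conj_tuple_in_mat_tuples[OF assms(2,1)]] self_in_conj_orbit[OF assms(1)]
      conj_orbit_conj_tuple[OF assms(2,1)] by simp
qed

text \<open>Conjugacy is witnessed by a single invertible matrix; its inverse need not be written down.\<close>
lemma deg_le_of_intertwiner_left:
  assumes A: "A \<in> mat_tuples n m" and B: "B \<in> mat_tuples n m" and g: "g \<in> carrier_mat n n" "det g \<noteq> 0"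
    and e: "\<And>i. i < m \<Longrightarrow> g * A ! i = B ! i * g"
  shows "deg_le n m A B"
proof -
  obtain h where p: "inverse_pair n g h" using inverse_pair_of_det[OF g] .
  have "B = conj_tuple g h A"
  proof (rule nth_equalityI)
    fix i assume "i < length B"
    then have i: "i < m" using B by (simp add: mat_tuples_def)
    have Bi: "B ! i \<in> carrier_mat n n" using B i by (auto simp: mat_tuples_def)
    have "g * A ! i * h = B ! i * (g * h)"
      unfolding e[OF i] using Bi p by (auto simp: inverse_pair_def)
    then show "B ! i = conj_tuple g h A ! i" using i A Bi p by (simp add: conj_tuple_def inverse_pair_def mat_tuples_def)
  qed (use A B in \<open>auto simp: conj_tuple_def mat_tuples_def\<close>)
  then show ?thesis using deg_le_conj_tuple[OF A p] by simp
qed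

lemma deg_le_of_intertwiner_right:
  assumes A: "A \<in> mat_tuples n m" and B: "B \<in> mat_tuples n m" and h: "h \<in> carrier_mat n n" "det h \<noteq> 0"
    and e: "\<And>i. i < m \<Longrightarrow> A ! i * h = h * B ! i"
  shows "deg_le n m A B"
proof -
  obtain g where p: "inverse_pair n h g" using inverse_pair_of_det[OF h] .
  have "A = conj_tuple h g B"
  proof (rule nth_equalityI)
    fix i assume "i < length A"
    then have i: "i < m" using A by (simp add: mat_tuples_def)
    have Ai: "A ! i \<in> carrier_mat n n" using A i by (auto simp: mat_tuples_def)
    have "h * B ! i * g = A ! i * (h * g)"
      unfolding e[OF i, symmetric] using Ai p by (auto simp: inverse_pair_def)
    then show "A ! i = conj_tuple h g B ! i" using i B Ai p by (simp add: conj_tuple_def inverse_pair_def mat_tuples_def)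
  qed (use A B in \<open>auto simp: conj_tuple_def mat_tuples_def\<close>)
  then show ?thesis using deg_le_conj_tuple(2)[OF B p] by simp
qed

text \<open>Over a finite field, \<open>\<Prod>\<^sub>a (X - a) + 1\<close> has no root.\<close>
lemma infinite_UNIV_alg_closed_field: "infinite (UNIV :: 'k::alg_closed_field set)"
proof
  assume fin: "finite (UNIV :: 'k set)"
  define p where "p = (\<Prod>a\<in>UNIV. [:- a, 1 :: 'k:]) + 1"
  have d: "degree (\<Prod>a\<in>UNIV. [:- a, 1 :: 'k:]) = card (UNIV :: 'k set)"
    by (subst degree_prod_eq_sum_degree) auto
  moreover have "card (UNIV :: 'k set) > 0" using fin by (simp add: card_gt_0_iff)
  ultimately have "degree p > 0" unfolding p_def by (subst degree_add_eq_left) auto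
  then obtain x where "poly p x = 0" using alg_closed_imp_poly_has_root by blast
  moreover have "poly p x = 1" using fin by (auto simp: p_def poly_prod prod_zero_iff)
  ultimately show False by simp
qed

text \<open>Along a polynomial curve, a polynomial function that vanishes on the orbit becomes a polynomial in the
  parameter. It is zero because it has infinitely many zeros. All degenerations that leave the orbit are
  obtained in this way.\<close>
lemma deg_le_limit:
  fixes A :: "'k::alg_closed_field mat list"
  assumes A: "A \<in> mat_tuples n m" and G: "\<And>u. G u \<in> mat_tuples n m"
    and poly: "\<And>r i j. r < m \<Longrightarrow> i < n \<Longrightarrow> j < n \<Longrightarrow> \<exists>p. \<forall>u. (G u ! r) $$ (i,j) = poly p u"
    and q: "q \<noteq> 0" "\<And>u. poly q u \<noteq> 0 \<Longrightarrow> deg_le n m A (G u)"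
  shows "deg_le n m A (G t)"
  unfolding deg_le_iff[OF A]
proof (intro conjI allI impI G)
  fix F assume F: "regular n m F" "\<forall>X \<in> conj_orbit n A. F X = 0"
  have pf: "\<exists>p. \<forall>u. f (G u) = poly p u" if "f \<in> poly_funs n m" for f
    using that
  proof induction
    case (const c) then show ?case by (intro exI[of _ "[:c:]"]) simp
  next
    case (coord r i j) then show ?case using poly by simp
  next
    case (add f g) then show ?case by (metis poly_add)
  next
    case (mult f g) then show ?case by (metis poly_mult)
  qed
  obtain f where f: "f \<in> poly_funs n m" "\<And>X. X \<in> mat_tuples n m \<Longrightarrow> F X = f X"
    using F unfolding regular_def by blast
  then obtain p where p: "\<And>u. F (G u) = poly p u" using pf G by metis
  have "poly p u = 0" if "poly q u \<noteq> 0" for u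
    using q(2)[OF that] F p by (metis deg_le_iff[OF A])
  then have "poly (p * q) u = 0" for u by (cases "poly q u = 0") auto
  then have "p * q = 0" using poly_roots_finite[of "p * q"] infinite_UNIV_alg_closed_field by auto
  then show "F (G t) = 0" using p q(1) by simp
qed

section \<open>Degeneration implies the rank inequalities\<close>

lemma free_alg_single: "w \<in> lists {..<m} \<Longrightarrow> Poly_Mapping.single w c \<in> free_alg m"
  by (auto simp: free_alg_def)

lemma free_alg_zero: "0 \<in> free_alg m"
  by (simp add: free_alg_def)

lemma free_alg_add: "p \<in> free_alg m \<Longrightarrow> q \<in> free_alg m \<Longrightarrow> p + q \<in> free_alg m"
  using Poly_Mapping.keys_add[of p q] unfolding free_alg_def by blast

lemma free_alg_sum: "(\<And>x. x \<in> S \<Longrightarrow> p x \<in> free_alg m) \<Longrightarrow> sum p S \<in> free_alg m"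
  by (induction S rule: infinite_finite_induct) (auto intro: free_alg_add free_alg_zero)

lemma eval_word_Nil: "eval_word n A [] = 1\<^sub>m n"
  by (simp add: eval_word_def)

lemma eval_word_Cons: "eval_word n A (i # w) = A ! i * eval_word n A w"
  by (simp add: eval_word_def)

lemma nth_mat_tuples: "A \<in> mat_tuples n m \<Longrightarrow> i < m \<Longrightarrow> A ! i \<in> carrier_mat n n"
  by (auto simp: mat_tuples_def)

lemma eval_word_carrier:
  "A \<in> mat_tuples n m \<Longrightarrow> w \<in> lists {..<m} \<Longrightarrow> eval_word n A w \<in> carrier_mat n n"
  by (induction w) (auto simp: eval_word_Nil eval_word_Cons intro!: mult_carrier_mat[OF nth_mat_tuples])

lemma eval_word_append:
  assumes A: "A \<in> mat_tuples n m" and "u \<in> lists {..<m}" and v: "v \<in> lists {..<m}"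
  shows "eval_word n A (u @ v) = eval_word n A u * eval_word n A v"
  using assms(2)
proof (induction u)
  case Nil then show ?case using eval_word_carrier[OF A v] by (simp add: eval_word_Nil)
next
  case (Cons i u)
  then show ?case
    using assoc_mult_mat[OF nth_mat_tuples[OF A, of i] eval_word_carrier[OF A] eval_word_carrier[OF A v], of u]
    by (simp add: eval_word_Cons)
qed

lemma eval_word_conj_tuple:
  assumes p: "inverse_pair n g h" and A: "A \<in> mat_tuples n m" and "w \<in> lists {..<m}"
  shows "eval_word n (conj_tuple g h A) w = g * eval_word n A w * h"
  using assms(3)
proof (induction w)
  case Nil then show ?case using p by (auto simp: eval_word_Nil inverse_pair_def)
next
  case (Cons i w)
  define X Y where "X = A ! i" and "Y = eval_word n A w"
  have i: "i < m" "i < length A" using Cons A by (auto simp: mat_tuples_def)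
  have c: "X \<in> carrier_mat n n" "Y \<in> carrier_mat n n" "g \<in> carrier_mat n n" "h \<in> carrier_mat n n"
    and hg: "h * g = 1\<^sub>m n"
    using Cons nth_mat_tuples[OF A i(1)] eval_word_carrier[OF A, of w] p
    by (auto simp: X_def Y_def inverse_pair_def)
  have "eval_word n (conj_tuple g h A) (i # w) = g * X * h * (g * Y * h)"
    using Cons i by (simp add: eval_word_Cons conj_tuple_def X_def Y_def)
  also have "\<dots> = g * X * (h * g) * Y * h" using c by (simp add: assoc_mult_mat[of _ n n _ n _ n])
  also have "\<dots> = g * (X * Y) * h" using c unfolding hg by (simp add: assoc_mult_mat[of _ n n _ n _ n])
  finally show ?case by (simp add: eval_word_Cons X_def Y_def)
qed

lemma eval_word_regular: "w \<in> lists {..<m} \<Longrightarrow> regular_mat n m n n (\<lambda>X. eval_word n X w)"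
  by (induction w) (auto simp: eval_word_Nil eval_word_Cons
      intro: regular_mat_const regular_mat_mult regular_mat_coord)

lemma eval_free_carrier [simp]: "eval_free n A p \<in> carrier_mat n n"
  by (simp add: eval_free_def)

lemma eval_free_index:
  assumes "i < n" "j < n" "finite S" "Poly_Mapping.keys p \<subseteq> S"
  shows "eval_free n A p $$ (i,j) = (\<Sum>w\<in>S. Poly_Mapping.lookup p w * eval_word n A w $$ (i,j))"
  using assms by (auto simp: eval_free_def in_keys_iff intro!: sum.mono_neutral_left)

lemma eval_free_add_index:
  assumes "i < n" "j < n"
  shows "eval_free n A (p + q) $$ (i,j) = eval_free n A p $$ (i,j) + eval_free n A q $$ (i,j)"
proof -
  let ?S = "Poly_Mapping.keys p \<union> Poly_Mapping.keys q"
  have "finite ?S" by simp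
  then show ?thesis
    using Poly_Mapping.keys_add[of p q] eval_free_index[OF assms, of ?S p A] eval_free_index[OF assms, of ?S q A]
      eval_free_index[OF assms, of ?S "p + q" A]
    by (simp add: lookup_add distrib_right sum.distrib)
qed

lemma eval_free_single_index:
  "i < n \<Longrightarrow> j < n \<Longrightarrow> eval_free n A (Poly_Mapping.single w c) $$ (i,j) = c * eval_word n A w $$ (i,j)"
  using eval_free_index[of i n j "{w}" "Poly_Mapping.single w c" A] by (simp add: lookup_single)

lemma eval_free_sum_index:
  assumes "i < n" "j < n"
  shows "eval_free n A (sum p S) $$ (i,j) = (\<Sum>x\<in>S. eval_free n A (p x) $$ (i,j))"
proof (induction S rule: infinite_finite_induct)
  case (insert x S)
  then show ?case using eval_free_add_index[OF assms, where p = "p x" and q = "sum p S" and A = A] by simp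
qed (use assms in \<open>auto simp: eval_free_def\<close>)

lemma conj_index:
  assumes "g \<in> carrier_mat n n" "X \<in> carrier_mat n n" "h \<in> carrier_mat n n" "i < n" "j < n"
  shows "(g * X * h) $$ (i,j) = (\<Sum>b\<in>{0..<n}. \<Sum>a\<in>{0..<n}. g $$ (i,a) * X $$ (a,b) * h $$ (b,j))"
  using assms by (simp add: scalar_prod_def sum_distrib_right del: assoc_mult_mat)

lemma eval_free_conj_tuple:
  assumes p: "inverse_pair n g h" and A: "A \<in> mat_tuples n m" and f: "f \<in> free_alg m"
  shows "eval_free n (conj_tuple g h A) f = g * eval_free n A f * h"
proof (rule eq_matI)
  have c: "g \<in> carrier_mat n n" "h \<in> carrier_mat n n" using p by (auto simp: inverse_pair_def)
  fix i j assume "i < dim_row (g * eval_free n A f * h)" "j < dim_col (g * eval_free n A f * h)"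
  then have ij: "i < n" "j < n" using c by auto
  let ?K = "Poly_Mapping.keys f" and ?c = "Poly_Mapping.lookup f"
  have w: "w \<in> lists {..<m}" if "w \<in> ?K" for w using f that unfolding free_alg_def by blast
  have "eval_free n (conj_tuple g h A) f $$ (i,j)
      = (\<Sum>w\<in>?K. ?c w * (\<Sum>b\<in>{0..<n}. \<Sum>a\<in>{0..<n}. g $$ (i,a) * eval_word n A w $$ (a,b) * h $$ (b,j)))"
    unfolding eval_free_index[OF ij finite_keys subset_refl]
    using eval_word_conj_tuple[OF p A w] conj_index[OF c(1) eval_word_carrier[OF A w] c(2) ij]
    by (intro sum.cong) auto
  also have "\<dots> = (\<Sum>b\<in>{0..<n}. \<Sum>a\<in>{0..<n}. g $$ (i,a) * (\<Sum>w\<in>?K. ?c w * eval_word n A w $$ (a,b)) * h $$ (b,j))"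
    unfolding sum_distrib_left sum_distrib_right
    by (subst sum.swap, rule sum.cong[OF refl], subst sum.swap, intro sum.cong refl) (simp add: mult.assoc mult.left_commute)
  also have "\<dots> = (\<Sum>b\<in>{0..<n}. \<Sum>a\<in>{0..<n}. g $$ (i,a) * eval_free n A f $$ (a,b) * h $$ (b,j))"
    by (intro sum.cong refl) (simp add: eval_free_index[OF _ _ finite_keys subset_refl])
  also have "\<dots> = (g * eval_free n A f * h) $$ (i,j)"
    using conj_index[OF c(1) eval_free_carrier c(2) ij] by simp
  finally show "eval_free n (conj_tuple g h A) f $$ (i,j) = (g * eval_free n A f * h) $$ (i,j)" .
qed (use p in \<open>auto simp: inverse_pair_def eval_free_def\<close>)

lemma eval_free_regular:
  fixes f :: "nat list \<Rightarrow>\<^sub>0 'k::field"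
  assumes "f \<in> free_alg m" shows "regular_mat n m n n (\<lambda>X. eval_free n X f)"
  unfolding regular_mat_def
proof (intro conjI ballI allI impI)
  fix i j assume ij: "i < n" "j < n"
  have w: "w \<in> lists {..<m}" if "w \<in> Poly_Mapping.keys f" for w using assms that unfolding free_alg_def by blast
  have "regular n m (\<lambda>X. \<Sum>w\<in>Poly_Mapping.keys f. Poly_Mapping.lookup f w * eval_word n X w $$ (i,j))"
  proof (intro regular_sum regular_mult regular_const)
    fix w assume "w \<in> Poly_Mapping.keys f"
    then have "regular_mat n m n n (\<lambda>X :: 'k mat list. eval_word n X w)" by (intro eval_word_regular w)
    then show "regular n m (\<lambda>X :: 'k mat list. eval_word n X w $$ (i,j))" using ij by (simp add: regular_mat_def)
  qed
  then show "regular n m (\<lambda>X. eval_free n X f $$ (i,j))"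
    by (simp add: eval_free_index[OF ij finite_keys subset_refl])
qed simp

text \<open>This is \<open>1\<^sub>k \<otimes> g\<close>: conjugating a tuple by \<open>g\<close> multiplies each block of \<open>\<phi>(A)\<close> by \<open>g\<close> and its
  inverse.\<close>
definition block_diag :: "nat \<Rightarrow> nat \<Rightarrow> 'k::field mat \<Rightarrow> 'k mat" where
  "block_diag n k g = mat (k * n) (k * n)
     (\<lambda>(r,c). if c div n = r div n then g $$ (r mod n, c mod n) else 0)"

lemma sum_over_block:
  fixes f :: "nat \<Rightarrow> 'a::comm_monoid_add"
  assumes "x < k"
  shows "(\<Sum>a\<in>{0..<k * n}. if a div n = x then f a else 0) = (\<Sum>y\<in>{0..<n}. f (x * n + y))"
proof -
  have "x * n + n \<le> k * n" using assms by (metis Suc_leI add.commute mult_Suc mult_le_mono1)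
  then have "{a \<in> {0..<k * n}. a div n = x} = (\<lambda>y. x * n + y) ` {0..<n}"
  proof (intro equalityI subsetI)
    fix a assume "a \<in> {a \<in> {0..<k * n}. a div n = x}"
    then have "a = x * n + a mod n" "n > 0" using div_mult_mod_eq[of a n] by (auto intro: Nat.gr0I)
    then show "a \<in> (\<lambda>y. x * n + y) ` {0..<n}" by (intro image_eqI[of _ _ "a mod n"]) auto
  next
    fix a assume "a \<in> (\<lambda>y. x * n + y) ` {0..<n}"
    then obtain y where "a = x * n + y" "y < n" by (elim imageE) simp
    then show "a \<in> {a \<in> {0..<k * n}. a div n = x}" using \<open>x * n + n \<le> k * n\<close> by simp
  qed
  moreover have "(\<Sum>a\<in>{0..<k * n}. if a div n = x then f a else 0) = sum f {a \<in> {0..<k * n}. a div n = x}"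
    by (simp add: sum.If_cases Int_def)
  moreover have "sum f ((\<lambda>y. x * n + y) ` {0..<n}) = (\<Sum>y\<in>{0..<n}. f (x * n + y))"
    by (subst sum.reindex) (auto simp: o_def)
  ultimately show ?thesis by (simp only:)
qed

lemma eval_mat_carrier: "\<phi> \<in> carrier_mat k l \<Longrightarrow> eval_mat n A \<phi> \<in> carrier_mat (k * n) (l * n)"
  by (auto simp: eval_mat_def)

lemma eval_mat_index:
  "\<phi> \<in> carrier_mat k l \<Longrightarrow> r < k * n \<Longrightarrow> c < l * n \<Longrightarrow>
    eval_mat n A \<phi> $$ (r,c) = eval_free n A (\<phi> $$ (r div n, c div n)) $$ (r mod n, c mod n)"
  by (auto simp: eval_mat_def)

lemma eval_mat_entry_in_free_alg:
  assumes "\<phi> \<in> carrier_mat k l" "elements_mat \<phi> \<subseteq> free_alg m" "r < k * n" "c < l * n"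
  shows "\<phi> $$ (r div n, c div n) \<in> free_alg m"
proof -
  have "r div n < k" "c div n < l" using assms by (auto simp: less_mult_imp_div_less)
  then show ?thesis using elements_matI[OF assms(1) _ _ refl] assms(2) by blast
qed

lemma eval_mat_conj_tuple:
  assumes p: "inverse_pair n g h" and A: "A \<in> mat_tuples n m"
    and \<phi>: "\<phi> \<in> carrier_mat k l" "elements_mat \<phi> \<subseteq> free_alg m"
  shows "eval_mat n (conj_tuple g h A) \<phi> = block_diag n k g * eval_mat n A \<phi> * block_diag n l h"
proof (rule eq_matI)
  let ?M = "eval_mat n A \<phi>"
  have c: "g \<in> carrier_mat n n" "h \<in> carrier_mat n n" using p by (auto simp: inverse_pair_def)
  have M: "?M \<in> carrier_mat (k * n) (l * n)" by (rule eval_mat_carrier[OF \<phi>(1)])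
  have G: "block_diag n k g \<in> carrier_mat (k * n) (k * n)" and H: "block_diag n l h \<in> carrier_mat (l * n) (l * n)"
    by (auto simp: block_diag_def)
  fix r s assume "r < dim_row (block_diag n k g * ?M * block_diag n l h)"
    "s < dim_col (block_diag n k g * ?M * block_diag n l h)"
  then have rs: "r < k * n" "s < l * n" by (auto simp: block_diag_def)
  then have n: "n > 0" by (cases n) auto
  define x y where "x = r div n" and "y = s div n"
  have xy: "x < k" "y < l" using rs by (auto simp: x_def y_def less_mult_imp_div_less)
  have xb: "x * n + a < k * n" if "a < n" for a
    using xy(1) that by (metis (no_types, lifting) add.commute add_less_cancel_right less_le_trans mult_Suc mult_le_mono1 Suc_leI)
  have yb: "y * n + b < l * n" if "b < n" for b
    using xy(2) that by (metis (no_types, lifting) add.commute add_less_cancel_right less_le_trans mult_Suc mult_le_mono1 Suc_leI)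
  define E where "E = eval_free n A (\<phi> $$ (x,y))"
  have left: "(block_diag n k g * ?M) $$ (r,t) = (\<Sum>a\<in>{0..<n}. g $$ (r mod n, a) * ?M $$ (x * n + a, t))"
    if "t < l * n" for t
  proof -
    have "(block_diag n k g * ?M) $$ (r,t)
        = (\<Sum>a\<in>{0..<k * n}. if a div n = x then g $$ (r mod n, a mod n) * ?M $$ (a, t) else 0)"
      using M rs that by (auto simp: scalar_prod_def block_diag_def x_def intro!: sum.cong)
    then show ?thesis using xy n by (simp add: sum_over_block)
  qed
  define N where "N = block_diag n k g * ?M"
  have N: "N \<in> carrier_mat (k * n) (l * n)" using G M by (simp add: N_def)
  have "(N * block_diag n l h) $$ (r,s)
      = (\<Sum>b\<in>{0..<l * n}. if b div n = y then N $$ (r,b) * h $$ (b mod n, s mod n) else 0)"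
    using N rs by (auto simp: scalar_prod_def block_diag_def y_def intro!: sum.cong)
  also have "\<dots> = (\<Sum>b\<in>{0..<n}. N $$ (r, y * n + b) * h $$ (b, s mod n))"
    using xy n by (simp add: sum_over_block)
  also have "\<dots> = (\<Sum>b\<in>{0..<n}. \<Sum>a\<in>{0..<n}. g $$ (r mod n, a) * E $$ (a, b) * h $$ (b, s mod n))"
    using xb yb n left[folded N_def]
    by (auto simp: E_def sum_distrib_right eval_mat_index[OF \<phi>(1)] intro!: sum.cong)
  also have "\<dots> = (g * E * h) $$ (r mod n, s mod n)"
    using conj_index[OF c(1) _ c(2), of E] n by (simp add: E_def)
  also have "\<dots> = eval_mat n (conj_tuple g h A) \<phi> $$ (r,s)"
    unfolding eval_mat_index[OF \<phi>(1) rs] E_def x_def y_def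
    using eval_free_conj_tuple[OF p A eval_mat_entry_in_free_alg[OF \<phi> rs]] by simp
  finally show "eval_mat n (conj_tuple g h A) \<phi> $$ (r,s) = (block_diag n k g * ?M * block_diag n l h) $$ (r,s)"
    by (simp add: N_def)
qed (use \<phi> in \<open>auto simp: block_diag_def eval_mat_def\<close>)

lemma eval_mat_regular:
  assumes \<phi>: "\<phi> \<in> carrier_mat k l" "elements_mat \<phi> \<subseteq> free_alg m"
  shows "regular_mat n m (k * n) (l * n) (\<lambda>X. eval_mat n X \<phi>)"
  unfolding regular_mat_def
proof (intro conjI ballI allI impI eval_mat_carrier[OF \<phi>(1)])
  fix r c assume rc: "r < k * n" "c < l * n"
  then have "0 < n" by (cases n) auto
  then show "regular n m (\<lambda>X. eval_mat n X \<phi> $$ (r,c))"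
    unfolding eval_mat_index[OF \<phi>(1) rc]
    using eval_free_regular[OF eval_mat_entry_in_free_alg[OF \<phi> rc], of n] by (simp add: regular_mat_def)
qed

text \<open>Lower semicontinuity of the rank, together with the fact that the rank of \<open>\<phi>\<close> is constant on
  orbits.\<close>
lemma deg_le_imp_hom_le:
  fixes A B :: "'k::field mat list"
  assumes A: "A \<in> mat_tuples n m" and d: "deg_le n m A B"
  shows "hom_le n m A B"
  unfolding hom_le_def
proof (intro allI ballI impI)
  fix k l and \<phi> :: "(nat list \<Rightarrow>\<^sub>0 'k) mat" assume \<phi>1: "\<phi> \<in> carrier_mat k l" and "1 \<le> k \<and> 1 \<le> l \<and> elements_mat \<phi> \<subseteq> free_alg m"
  then have \<phi>: "\<phi> \<in> carrier_mat k l" "elements_mat \<phi> \<subseteq> free_alg m" by auto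
  note M = eval_mat_carrier[OF \<phi>1, of n]
  let ?r = "vec_space.rank (k * n) (eval_mat n B \<phi>)"
  obtain P Q where P: "P \<in> carrier_mat ?r (k * n)" and Q: "Q \<in> carrier_mat (l * n) ?r"
    and nz: "det (P * eval_mat n B \<phi> * Q) \<noteq> 0"
    using le_rank_iff[OF M[of B], of ?r] by auto
  have "regular n m (\<lambda>X. det (P * eval_mat n X \<phi> * Q))"
    using regular_mat_const[OF P] regular_mat_const[OF Q] eval_mat_regular[OF \<phi>]
    by (intro regular_det regular_mat_mult)
  then obtain X where "X \<in> conj_orbit n A" and X: "det (P * eval_mat n X \<phi> * Q) \<noteq> 0"
    using d nz unfolding deg_le_iff[OF A] by blast
  then obtain g h where p: "inverse_pair n g h" and Xg: "X = conj_tuple g h A" by (auto simp: conj_orbit_eq)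
  let ?G = "block_diag n k g" and ?H = "block_diag n l h"
  have GH: "?G \<in> carrier_mat (k * n) (k * n)" "?H \<in> carrier_mat (l * n) (l * n)" by (auto simp: block_diag_def)
  have "P * eval_mat n X \<phi> * Q = (P * ?G) * eval_mat n A \<phi> * (?H * Q)"
    unfolding Xg eval_mat_conj_tuple[OF p A \<phi>] using P Q GH M[of A]
    by (simp add: assoc_mult_mat[of _ ?r "k * n" _ "k * n" _ "l * n"] assoc_mult_mat[of _ ?r "k * n" _ "l * n" _ "l * n"]
        assoc_mult_mat[of _ "k * n" "k * n" _ "l * n" _ "l * n"] assoc_mult_mat[of _ ?r "l * n" _ "l * n" _ ?r]
        assoc_mult_mat[of _ ?r "k * n" _ "l * n" _ ?r] assoc_mult_mat[of _ "k * n" "k * n" _ "l * n" _ ?r]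
        assoc_mult_mat[of _ "k * n" "l * n" _ "l * n" _ ?r])
  then show "?r \<le> vec_space.rank (k * n) (eval_mat n A \<phi>)"
    using X P Q GH le_rank_iff[OF M[of A], of ?r] by (metis mult_carrier_mat)
qed

lemma hom_le_trans: "hom_le n m A B \<Longrightarrow> hom_le n m B C \<Longrightarrow> hom_le n m A C"
  unfolding hom_le_def by (meson order_trans)

section \<open>Triangular form of tuples in the nullcone\<close>

lemma eval_word_zero_tuple:
  assumes "w \<in> lists {..<m}" "w \<noteq> []"
  shows "eval_word n (replicate m (0\<^sub>m n n :: 'k::field mat)) w = 0\<^sub>m n n"
proof (cases w)
  case (Cons i v)
  then have "eval_word n (replicate m (0\<^sub>m n n :: 'k mat)) v \<in> carrier_mat n n" "i < m"
    using assms by (auto intro!: eval_word_carrier[of _ n m] simp: mat_tuples_def)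
  then show ?thesis using Cons by (simp add: eval_word_Cons)
qed (use assms in simp)

lemma eval_free_zero_tuple:
  fixes p :: "nat list \<Rightarrow>\<^sub>0 'k::field"
  assumes p: "p \<in> free_alg m" "Poly_Mapping.lookup p [] = 0"
  shows "eval_free n (replicate m (0\<^sub>m n n)) p = 0\<^sub>m n n"
proof (rule eq_matI)
  fix i j assume "i < dim_row (0\<^sub>m n n :: 'k mat)" "j < dim_col (0\<^sub>m n n :: 'k mat)"
  then have ij: "i < n" "j < n" by auto
  have "Poly_Mapping.lookup p w * eval_word n (replicate m (0\<^sub>m n n)) w $$ (i,j) = 0"
    if "w \<in> Poly_Mapping.keys p" for w
  proof (cases "w = []")
    case False
    have "w \<in> lists {..<m}" using p(1) that unfolding free_alg_def by blast
    then have "eval_word n (replicate m (0\<^sub>m n n :: 'k mat)) w = 0\<^sub>m n n"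
      using False by (rule eval_word_zero_tuple)
    then show ?thesis using ij by simp
  qed (use p in simp)
  then show "eval_free n (replicate m (0\<^sub>m n n)) p $$ (i,j) = 0\<^sub>m n n $$ (i,j)"
    using ij by (simp add: eval_free_index[OF ij finite_keys subset_refl] sum.neutral)
qed (auto simp: eval_free_def)

text \<open>The determinant is a polynomial function that is constant on orbits, so it takes the same value at
  \<open>A\<close> as at the zero tuple. Consequently \<open>1\<close> is not an eigenvalue of any element of the non-unital algebra
  generated by \<open>A\<close>.\<close>
lemma nullcone_det:
  assumes A: "A \<in> nullcone n m" and p: "p \<in> free_alg m" "Poly_Mapping.lookup p [] = 0"
  shows "det (1\<^sub>m n - eval_free n A p) = 1"
proof -
  have At: "A \<in> mat_tuples n m" and d: "deg_le n m A (replicate m (0\<^sub>m n n))"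
    using A by (auto simp: nullcone_def deg_le_def)
  let ?F = "\<lambda>X. det (1\<^sub>m n - eval_free n X p) - det (1\<^sub>m n - eval_free n A p)"
  have "regular n m ?F"
    by (intro regular_diff regular_const regular_det[of _ _ n] regular_mat_diff regular_mat_const
        eval_free_regular[OF p(1)]) simp
  moreover have "?F X = 0" if XO: "X \<in> conj_orbit n A" for X
  proof -
    obtain g h where gh: "inverse_pair n g h" and X: "X = conj_tuple g h A"
      using XO by (auto simp: conj_orbit_eq)
    then have c: "g \<in> carrier_mat n n" "h \<in> carrier_mat n n" "g * h = 1\<^sub>m n" by (auto simp: inverse_pair_def)
    let ?E = "eval_free n A p"
    have "1\<^sub>m n - eval_free n X p = g * (1\<^sub>m n - ?E) * h"
      unfolding X eval_free_conj_tuple[OF gh At p(1)]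
      using c mult_minus_distrib_mat[OF c(1) one_carrier_mat eval_free_carrier[of n A p]]
        minus_mult_distrib_mat[OF c(1) mult_carrier_mat[OF c(1) eval_free_carrier[of n A p]] c(2)]
      by (simp del: assoc_mult_mat)
    then have "det (1\<^sub>m n - eval_free n X p) = det g * det (1\<^sub>m n - ?E) * det h"
      using det_mult[OF mult_carrier_mat[OF c(1) minus_carrier_mat] c(2)]
        det_mult[OF c(1) minus_carrier_mat] by simp
    moreover have "det g * det h = 1" using det_mult[OF c(1,2)] c(3) by simp
    ultimately show ?thesis by (simp add: mult.commute mult.left_commute)
  qed
  ultimately have "?F (replicate m (0\<^sub>m n n)) = 0" using d unfolding deg_le_iff[OF At] by blast
  moreover have "1\<^sub>m n - 0\<^sub>m n n = (1\<^sub>m n :: 'a mat)" by (intro eq_matI) auto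
  ultimately show ?thesis using eval_free_zero_tuple[OF p, of n] by simp
qed

lemma mat_eq_of_mult_vec:
  fixes M :: "'k::field mat"
  assumes M: "M \<in> carrier_mat k l" and N: "N \<in> carrier_mat k l"
    and eq: "\<And>v. v \<in> carrier_vec l \<Longrightarrow> M *\<^sub>v v = N *\<^sub>v v"
  shows "M = N"
proof (rule eq_matI)
  fix i j assume "i < dim_row N" "j < dim_col N"
  then have ij: "i < k" "j < l" using N by auto
  have "X $$ (i,j) = (X *\<^sub>v unit_vec l j) $ i" if "X \<in> carrier_mat k l" for X :: "'k mat"
    using that ij by simp
  then show "M $$ (i,j) = N $$ (i,j)" using M N eq[of "unit_vec l j"] by (metis unit_vec_carrier)
qed (use M N in auto)

lemma zero_mat_of_mult_vec:
  fixes M :: "'k::field mat"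
  assumes M: "M \<in> carrier_mat k l" and z: "\<And>v. v \<in> carrier_vec l \<Longrightarrow> M *\<^sub>v v = 0\<^sub>v k"
  shows "M = 0\<^sub>m k l"
  by (rule mat_eq_of_mult_vec[OF M]) (use z in auto)

text \<open>The algebra generated by a tuple of the nullcone is nilpotent. Let the suffixes of \<open>w\<close> act on a
  vector \<open>v\<close>. The resulting \<open>n + 1\<close> vectors \<open>u\<^sub>0 = v, \<dots>, u\<^sub>n\<close> are linearly dependent. Solving a dependency
  for the first vector \<open>u\<^sub>s\<close> that occurs in it gives \<open>u\<^sub>s = p(A) u\<^sub>s\<close> with \<open>p\<close> free of constant term, because
  each later vector arises from \<open>u\<^sub>s\<close> by a nonempty word. So \<open>u\<^sub>s = 0\<close>, and with it \<open>u\<^sub>n = 0\<close>.\<close>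
lemma nullcone_word_zero:
  fixes A :: "'k::field mat list"
  assumes A: "A \<in> nullcone n m" and w: "w \<in> lists {..<m}" and len: "length w = n"
  shows "eval_word n A w = 0\<^sub>m n n"
proof (rule zero_mat_of_mult_vec)
  have At: "A \<in> mat_tuples n m" using A by (simp add: nullcone_def)
  show "eval_word n A w \<in> carrier_mat n n" by (rule eval_word_carrier[OF At w])
  fix v :: "'k vec" assume v: "v \<in> carrier_vec n"
  define u where "u j = eval_word n A (drop (n - j) w) *\<^sub>v v" for j
  have dropw: "drop k w \<in> lists {..<m}" for k using w by (auto dest: in_set_dropD)
  have u: "u j \<in> carrier_vec n" for j
    unfolding u_def by (rule mult_mat_vec_carrier[OF eval_word_carrier[OF At dropw] v])
  define C where "C = mat n (Suc n) (\<lambda>(i,j). u j $ i)"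
  have "C \<in> carrier_mat n (Suc n)" by (simp add: C_def)
  then obtain c where c: "c \<in> carrier_vec (Suc n)" "c \<noteq> 0\<^sub>v (Suc n)" "C *\<^sub>v c = 0\<^sub>v n"
    using wide_matrix_kernel[of C n "Suc n"] by auto
  have rel: "(\<Sum>j\<in>{0..<Suc n}. c $ j * u j $ i) = 0" if "i < n" for i
    using arg_cong[OF c(3), of "\<lambda>x. x $ i"] that c(1)
    by (simp add: C_def scalar_prod_def mult.commute del: sum.op_ivl_Suc)
  have "\<exists>j. j < Suc n \<and> c $ j \<noteq> 0"
  proof (rule ccontr)
    assume "\<not> (\<exists>j. j < Suc n \<and> c $ j \<noteq> 0)"
    then have "c = 0\<^sub>v (Suc n)" using c(1) by (intro eq_vecI) auto
    then show False using c(2) by simp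
  qed
  then obtain s where s: "s < Suc n" "c $ s \<noteq> 0" and least: "\<And>j. j < s \<Longrightarrow> c $ j = 0"
    using exists_least_iff[of "\<lambda>j. j < Suc n \<and> c $ j \<noteq> 0"] by (metis less_trans)
  define t where "t j = take (j - s) (drop (n - j) w)" for j
  have tw: "t j \<in> lists {..<m}" for j using w unfolding t_def by (auto dest: in_set_takeD in_set_dropD)
  have ut: "u j = eval_word n A (t j) *\<^sub>v u s" if "s \<le> j" "j \<le> n" for j
  proof -
    have "drop (n - j) w = t j @ drop (n - s) w"
      using that append_take_drop_id[of "j - s" "drop (n - j) w"] by (simp add: t_def)
    then show ?thesis
      unfolding u_def using eval_word_append[OF At tw[of j] dropw[of "n - s"]]
        assoc_mult_mat_vec[OF eval_word_carrier[OF At tw[of j]] eval_word_carrier[OF At dropw[of "n - s"]] v]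
      by simp
  qed
  \<comment> \<open>The dependency solved for \<open>u s\<close>; \<open>t j\<close> is the word leading from \<open>u s\<close> to \<open>u j\<close>.\<close>
  define p where "p = (\<Sum>j\<in>{Suc s..<Suc n}. Poly_Mapping.single (t j) (- c $ j / c $ s))"
  have p: "p \<in> free_alg m" unfolding p_def by (intro free_alg_sum free_alg_single tw)
  have "t j \<noteq> []" if "j \<in> {Suc s..<Suc n}" for j using that len by (auto simp: t_def)
  then have "Poly_Mapping.lookup p [] = 0" unfolding p_def lookup_sum
    by (intro sum.neutral) (simp add: lookup_single)
  then have det1: "det (1\<^sub>m n - eval_free n A p) = 1" by (rule nullcone_det[OF A p])
  have "(1\<^sub>m n - eval_free n A p) *\<^sub>v u s = 0\<^sub>v n"
  proof (rule eq_vecI)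
    fix i assume "i < dim_vec (0\<^sub>v n :: 'k vec)"
    then have i: "i < n" by simp
    have "(eval_free n A p *\<^sub>v u s) $ i = (\<Sum>l\<in>{0..<n}. eval_free n A p $$ (i,l) * u s $ l)"
      using i u[of s] by (simp add: scalar_prod_def eval_free_def)
    also have "\<dots> = (\<Sum>l\<in>{0..<n}. \<Sum>j\<in>{Suc s..<Suc n}. - c $ j / c $ s * (eval_word n A (t j) $$ (i,l) * u s $ l))"
      using i by (intro sum.cong refl)
        (simp add: p_def eval_free_sum_index eval_free_single_index sum_distrib_right mult.assoc del: sum.op_ivl_Suc)
    also have "\<dots> = (\<Sum>j\<in>{Suc s..<Suc n}. - c $ j / c $ s * u j $ i)"
    proof (subst sum.swap, rule sum.cong[OF refl])
      fix j assume j: "j \<in> {Suc s..<Suc n}"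
      have "u j $ i = (\<Sum>l\<in>{0..<n}. eval_word n A (t j) $$ (i,l) * u s $ l)"
        using ut[of j] j i u[of s] eval_word_carrier[OF At tw[of j]] by (simp add: scalar_prod_def)
      then show "(\<Sum>l\<in>{0..<n}. - c $ j / c $ s * (eval_word n A (t j) $$ (i,l) * u s $ l)) = - c $ j / c $ s * u j $ i"
        by (simp add: sum_distrib_left)
    qed
    also have "\<dots> = - (1 / c $ s) * (\<Sum>j\<in>{Suc s..<Suc n}. c $ j * u j $ i)"
      by (simp add: sum_distrib_left sum_negf del: sum.op_ivl_Suc)
    also have "(\<Sum>j\<in>{Suc s..<Suc n}. c $ j * u j $ i) = - (c $ s * u s $ i)"
    proof -
      have "(\<Sum>j\<in>{0..<Suc n}. c $ j * u j $ i) = (\<Sum>j\<in>{0..<s}. c $ j * u j $ i) + (\<Sum>j\<in>{s..<Suc n}. c $ j * u j $ i)"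
        using s(1) by (simp add: sum.atLeastLessThan_concat del: sum.op_ivl_Suc)
      also have "(\<Sum>j\<in>{0..<s}. c $ j * u j $ i) = 0" using least by (intro sum.neutral) simp
      also have "(\<Sum>j\<in>{s..<Suc n}. c $ j * u j $ i) = c $ s * u s $ i + (\<Sum>j\<in>{Suc s..<Suc n}. c $ j * u j $ i)"
        using s(1) by (simp add: sum.atLeast_Suc_lessThan del: sum.op_ivl_Suc)
      finally show ?thesis using rel[OF i] by (simp add: eq_neg_iff_add_eq_0 add.commute del: sum.op_ivl_Suc)
    qed
    finally have "(eval_free n A p *\<^sub>v u s) $ i = u s $ i" using s(2) by simp
    moreover have "(1\<^sub>m n - eval_free n A p) *\<^sub>v u s = 1\<^sub>m n *\<^sub>v u s - eval_free n A p *\<^sub>v u s"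
      by (rule minus_mult_distrib_mat_vec[of _ n n]) (use u in auto)
    moreover have "dim_vec (eval_free n A p *\<^sub>v u s) = n" by (simp add: eval_free_def)
    ultimately show "((1\<^sub>m n - eval_free n A p) *\<^sub>v u s) $ i = 0\<^sub>v n $ i" using i u[of s] by simp
  qed (simp add: eval_free_def)
  then have "u s = 0\<^sub>v n"
    using det_0_iff_vec_prod_zero_field[of "1\<^sub>m n - eval_free n A p" n] det1 u[of s]
    by (metis eval_free_carrier minus_carrier_mat zero_neq_one)
  then have "u n = 0\<^sub>v n" using ut[of n] s(1) mat_mult_zero_vec[OF eval_word_carrier[OF At tw[of n]]] by simp
  then show "eval_word n A w *\<^sub>v v = 0\<^sub>v n" by (simp add: u_def)
qed

text \<open>The arguments are the entries in positions \<open>(0,1)\<close>, \<open>(1,2)\<close> and \<open>(0,2)\<close>: the corner comes last.\<close>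
definition strict_upper :: "'k::field \<Rightarrow> 'k \<Rightarrow> 'k \<Rightarrow> 'k mat" where
  "strict_upper a b c = mat 3 3 (\<lambda>(i,j). if (i,j) = (0,1) then a else if (i,j) = (1,2) then b
     else if (i,j) = (0,2) then c else 0)"

definition strict_upper_tuple :: "nat \<Rightarrow> (nat \<Rightarrow> 'k::field) \<Rightarrow> (nat \<Rightarrow> 'k) \<Rightarrow> (nat \<Rightarrow> 'k) \<Rightarrow> 'k mat list" where
  "strict_upper_tuple m a b c = map (\<lambda>i. strict_upper (a i) (b i) (c i)) [0..<m]"

lemma strict_upper_carrier [simp]: "strict_upper a b c \<in> carrier_mat 3 3"
  by (simp add: strict_upper_def)

lemma strict_upper_index [simp]:
  "strict_upper a b c $$ (0,0) = 0" "strict_upper a b c $$ (0,1) = a" "strict_upper a b c $$ (0,2) = c"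
  "strict_upper a b c $$ (1,0) = 0" "strict_upper a b c $$ (1,1) = 0" "strict_upper a b c $$ (1,2) = b"
  "strict_upper a b c $$ (2,0) = 0" "strict_upper a b c $$ (2,1) = 0" "strict_upper a b c $$ (2,2) = 0"
  by (auto simp: strict_upper_def)

lemmas strict_upper_index_Suc [simp] = strict_upper_index[unfolded One_nat_def]

lemma strict_upper_tuple_in_mat_tuples [simp]: "strict_upper_tuple m a b c \<in> mat_tuples 3 m"
  by (auto simp: strict_upper_tuple_def mat_tuples_def)

lemma length_strict_upper_tuple [simp]: "length (strict_upper_tuple m a b c) = m"
  by (simp add: strict_upper_tuple_def)

lemma nth_strict_upper_tuple [simp]: "i < m \<Longrightarrow> strict_upper_tuple m a b c ! i = strict_upper (a i) (b i) (c i)"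
  by (simp add: strict_upper_tuple_def)

lemma less_3_iff: "i < (3::nat) \<longleftrightarrow> i = 0 \<or> i = 1 \<or> i = 2"
  by auto

lemma sum_up_to_3: "(\<Sum>l\<in>{0..<3}. f l) = f 0 + f 1 + (f (2::nat) :: 'a::comm_monoid_add)"
  by (simp add: numeral_3_eq_3 numeral_2_eq_2)

lemma mat3_eqI:
  assumes "X \<in> carrier_mat 3 3" "Y \<in> carrier_mat 3 3"
    and "\<And>i j. i < 3 \<Longrightarrow> j < 3 \<Longrightarrow> X $$ (i,j) = Y $$ (i,j)"
  shows "X = Y"
  using assms by (intro eq_matI) auto

lemma mat3_mult_index:
  assumes "X \<in> carrier_mat k 3" "Y \<in> carrier_mat 3 l" "i < k" "j < l"
  shows "(X * Y) $$ (i,j) = X $$ (i,0) * Y $$ (0,j) + X $$ (i,1) * Y $$ (1,j) + X $$ (i,2) * Y $$ (2,j)"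
  using assms by (simp add: scalar_prod_def sum_up_to_3)

lemma mat3_mult_vec_index:
  assumes "X \<in> carrier_mat k 3" "v \<in> carrier_vec 3" "i < k"
  shows "(X *\<^sub>v v) $ i = X $$ (i,0) * v $ 0 + X $$ (i,1) * v $ 1 + X $$ (i,2) * v $ 2"
  using assms by (simp add: scalar_prod_def sum_up_to_3)

text \<open>Defined entrywise so that sums of multiples of vectors need no dimension side conditions.\<close>
definition comb3 :: "'k::field vec \<Rightarrow> 'k vec \<Rightarrow> 'k vec \<Rightarrow> 'k \<Rightarrow> 'k \<Rightarrow> 'k \<Rightarrow> 'k vec" where
  "comb3 u v w x y z = vec 3 (\<lambda>i. x * u $ i + y * v $ i + z * w $ i)"

lemma comb3_carrier [simp]: "comb3 u v w x y z \<in> carrier_vec 3"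
  by (simp add: comb3_def)

lemma mult_comb3:
  assumes "X \<in> carrier_mat 3 3" "u \<in> carrier_vec 3" "v \<in> carrier_vec 3" "w \<in> carrier_vec 3"
  shows "X *\<^sub>v comb3 u v w x y z = comb3 (X *\<^sub>v u) (X *\<^sub>v v) (X *\<^sub>v w) x y z"
proof (rule eq_vecI)
  fix i assume "i < dim_vec (comb3 (X *\<^sub>v u) (X *\<^sub>v v) (X *\<^sub>v w) x y z)"
  then have i: "i < 3" by (simp add: comb3_def)
  show "(X *\<^sub>v comb3 u v w x y z) $ i = comb3 (X *\<^sub>v u) (X *\<^sub>v v) (X *\<^sub>v w) x y z $ i"
    using i assms mat3_mult_vec_index[OF assms(1) _ i] by (simp add: comb3_def algebra_simps del: index_mult_mat_vec)
qed (use assms in \<open>simp add: comb3_def\<close>)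

lemma comb3_single_eq_zero:
  assumes "e \<in> carrier_vec 3" "e \<noteq> 0\<^sub>v 3"
  shows "comb3 e (0\<^sub>v 3) (0\<^sub>v 3) x y z = 0\<^sub>v 3 \<longleftrightarrow> x = 0"
    "comb3 (0\<^sub>v 3) e (0\<^sub>v 3) x y z = 0\<^sub>v 3 \<longleftrightarrow> y = 0"
    "comb3 (0\<^sub>v 3) (0\<^sub>v 3) e x y z = 0\<^sub>v 3 \<longleftrightarrow> z = 0"
    "comb3 e v w x 0 0 = 0\<^sub>v 3 \<longleftrightarrow> x = 0"
proof -
  obtain i where i: "i < 3" "e $ i \<noteq> 0"
    using assms by (metis eq_vecI carrier_vecD index_zero_vec)
  have zero: "f i = 0" if "vec 3 f = 0\<^sub>v 3" for f
    using arg_cong[OF that, of "\<lambda>x. x $ i"] i by simp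
  have nz: "vec 3 f = 0\<^sub>v 3" if "\<And>j. j < 3 \<Longrightarrow> f j = 0" for f
    using that by (intro eq_vecI) auto
  show "comb3 e (0\<^sub>v 3) (0\<^sub>v 3) x y z = 0\<^sub>v 3 \<longleftrightarrow> x = 0"
    using zero[of "\<lambda>i. x * e $ i + y * 0\<^sub>v 3 $ i + z * 0\<^sub>v 3 $ i"] i by (auto simp: comb3_def intro!: nz)
  show "comb3 (0\<^sub>v 3) e (0\<^sub>v 3) x y z = 0\<^sub>v 3 \<longleftrightarrow> y = 0"
    using zero[of "\<lambda>i. x * 0\<^sub>v 3 $ i + y * e $ i + z * 0\<^sub>v 3 $ i"] i by (auto simp: comb3_def intro!: nz)
  show "comb3 (0\<^sub>v 3) (0\<^sub>v 3) e x y z = 0\<^sub>v 3 \<longleftrightarrow> z = 0"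
    using zero[of "\<lambda>i. x * 0\<^sub>v 3 $ i + y * 0\<^sub>v 3 $ i + z * e $ i"] i by (auto simp: comb3_def intro!: nz)
  show "comb3 e v w x 0 0 = 0\<^sub>v 3 \<longleftrightarrow> x = 0"
    using zero[of "\<lambda>i. x * e $ i + 0 * v $ i + 0 * w $ i"] i by (auto simp: comb3_def intro!: nz)
qed

definition indep3 :: "'k::field vec \<Rightarrow> 'k vec \<Rightarrow> 'k vec \<Rightarrow> bool" where
  "indep3 u v w \<longleftrightarrow> u \<in> carrier_vec 3 \<and> v \<in> carrier_vec 3 \<and> w \<in> carrier_vec 3 \<and>
     (\<forall>x y z. comb3 u v w x y z = 0\<^sub>v 3 \<longrightarrow> x = 0 \<and> y = 0 \<and> z = 0)"

lemma indep3_basis: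
  assumes "indep3 u v w"
  obtains g h where "inverse_pair 3 g h"
    "\<And>x. x \<in> carrier_vec 3 \<Longrightarrow> g *\<^sub>v x = comb3 u v w (x $ 0) (x $ 1) (x $ 2)"
proof -
  define g where "g = mat 3 3 (\<lambda>(i,j). (if j = 0 then u else if j = 1 then v else w) $ i)"
  have g: "g \<in> carrier_mat 3 3" by (simp add: g_def)
  have gx: "g *\<^sub>v x = comb3 u v w (x $ 0) (x $ 1) (x $ 2)" if "x \<in> carrier_vec 3" for x
  proof (rule eq_vecI)
    fix i assume "i < dim_vec (comb3 u v w (x $ 0) (x $ 1) (x $ 2))"
    then have "i < 3" by (simp add: comb3_def)
    then show "(g *\<^sub>v x) $ i = comb3 u v w (x $ 0) (x $ 1) (x $ 2) $ i"
      using mat3_mult_vec_index[OF g that] by (simp add: g_def comb3_def mult.commute)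
  qed (simp add: g_def comb3_def)
  have "det g \<noteq> 0"
  proof
    assume "det g = 0"
    then obtain x where x: "x \<in> carrier_vec 3" "x \<noteq> 0\<^sub>v 3" "g *\<^sub>v x = 0\<^sub>v 3"
      using det_0_iff_vec_prod_zero_field[OF g] by auto
    then have "x $ 0 = 0 \<and> x $ 1 = 0 \<and> x $ 2 = 0" using gx assms by (metis indep3_def)
    then have "x = 0\<^sub>v 3" using x(1) by (intro eq_vecI) (auto simp: less_3_iff)
    with x(2) show False by simp
  qed
  then obtain h where "inverse_pair 3 g h" using inverse_pair_of_det[OF g] by blast
  then show thesis using gx that by blast
qed

lemma indep3_expand:
  assumes "indep3 u v w" "t \<in> carrier_vec 3"
  obtains x y z where "t = comb3 u v w x y z"
proof -
  obtain g h where p: "inverse_pair 3 g h"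
    and gx: "\<And>x. x \<in> carrier_vec 3 \<Longrightarrow> g *\<^sub>v x = comb3 u v w (x $ 0) (x $ 1) (x $ 2)"
    using indep3_basis[OF assms(1)] by metis
  have c: "g \<in> carrier_mat 3 3" "h \<in> carrier_mat 3 3" "g * h = 1\<^sub>m 3" using p by (auto simp: inverse_pair_def)
  have "t = (g * h) *\<^sub>v t" using c(3) assms(2) by simp
  also have "\<dots> = g *\<^sub>v (h *\<^sub>v t)" using c assms(2) by (intro assoc_mult_mat_vec) auto
  also have "\<dots> = comb3 u v w ((h *\<^sub>v t) $ 0) ((h *\<^sub>v t) $ 1) ((h *\<^sub>v t) $ 2)"
    by (rule gx[OF mult_mat_vec_carrier[OF c(2) assms(2)]])
  finally show thesis by (rule that)
qed

lemma strict_upper_tuple_of_basis: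
  assumes A: "A \<in> mat_tuples 3 m" and ind: "indep3 u v w"
    and uvw: "\<And>i. i < m \<Longrightarrow> \<exists>a b c. A ! i *\<^sub>v u = 0\<^sub>v 3 \<and> A ! i *\<^sub>v v = comb3 u v w a 0 0 \<and>
      A ! i *\<^sub>v w = comb3 u v w c b 0"
  shows "\<exists>g h a b c. inverse_pair 3 g h \<and> A = conj_tuple g h (strict_upper_tuple m a b c)"
proof -
  have c: "u \<in> carrier_vec 3" "v \<in> carrier_vec 3" "w \<in> carrier_vec 3" using ind by (auto simp: indep3_def)
  from uvw obtain a b c where abc: "\<And>i. i < m \<Longrightarrow> A ! i *\<^sub>v u = 0\<^sub>v 3 \<and>
      A ! i *\<^sub>v v = comb3 u v w (a i) 0 0 \<and> A ! i *\<^sub>v w = comb3 u v w (c i) (b i) 0" by metis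
  obtain g h where p: "inverse_pair 3 g h"
    and gx: "\<And>x. x \<in> carrier_vec 3 \<Longrightarrow> g *\<^sub>v x = comb3 u v w (x $ 0) (x $ 1) (x $ 2)"
    using indep3_basis[OF ind] by metis
  have gh: "g \<in> carrier_mat 3 3" "h \<in> carrier_mat 3 3" "g * h = 1\<^sub>m 3" using p by (auto simp: inverse_pair_def)
  have "A = conj_tuple g h (strict_upper_tuple m a b c)"
  proof (rule nth_equalityI)
    fix i assume "i < length A"
    then have i: "i < m" using A by (simp add: mat_tuples_def)
    note Ai = nth_mat_tuples[OF A i]
    let ?U = "strict_upper (a i) (b i) (c i)"
    have "A ! i * g = g * ?U"
    proof (rule mat_eq_of_mult_vec[OF mult_carrier_mat[OF Ai gh(1)] mult_carrier_mat[OF gh(1) strict_upper_carrier]])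
      fix x :: "'a vec" assume x: "x \<in> carrier_vec 3"
      have "(A ! i * g) *\<^sub>v x = A ! i *\<^sub>v (g *\<^sub>v x)" using Ai gh x by (intro assoc_mult_mat_vec)
      also have "\<dots> = comb3 (0\<^sub>v 3) (comb3 u v w (a i) 0 0) (comb3 u v w (c i) (b i) 0) (x $ 0) (x $ 1) (x $ 2)"
        using abc[OF i] by (simp add: gx[OF x] mult_comb3[OF Ai c])
      also have "\<dots> = comb3 u v w (a i * x $ 1 + c i * x $ 2) (b i * x $ 2) 0"
        by (intro eq_vecI) (auto simp: comb3_def algebra_simps)
      also have "\<dots> = g *\<^sub>v (?U *\<^sub>v x)"
        unfolding gx[OF mult_mat_vec_carrier[OF strict_upper_carrier x]]
        by (simp add: mat3_mult_vec_index[OF strict_upper_carrier x] del: index_mult_mat_vec)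
      also have "\<dots> = (g * ?U) *\<^sub>v x" using gh x by (intro assoc_mult_mat_vec[symmetric]) auto
      finally show "(A ! i * g) *\<^sub>v x = (g * ?U) *\<^sub>v x" .
    qed
    then have "g * ?U * h = A ! i * (g * h)" using Ai gh by (metis assoc_mult_mat)
    then show "A ! i = conj_tuple g h (strict_upper_tuple m a b c) ! i"
      using i Ai gh by (simp add: conj_tuple_def strict_upper_tuple_def)
  qed (use A in \<open>auto simp: conj_tuple_def strict_upper_tuple_def mat_tuples_def\<close>)
  then show ?thesis using p by blast
qed

text \<open>A basis \<open>e\<^sub>1, e\<^sub>2, e\<^sub>3\<close> adapted to the tuple is found by cases.
  If \<open>A\<^sub>i A\<^sub>j v \<noteq> 0\<close> for some \<open>v\<close>, then \<open>A\<^sub>i A\<^sub>j v, A\<^sub>j v, v\<close> is such a basis: applying \<open>A\<^sub>i A\<^sub>j\<close> and \<open>A\<^sub>i\<close> to a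
  linear combination reads off its last two coefficients, since triple products vanish.
  Otherwise all products vanish, and unless the tuple is zero there is a vector \<open>e = A\<^sub>i v \<noteq> 0\<close> in the
  common kernel. If the common kernel contains a vector \<open>w\<close> outside the line of \<open>e\<close>, the basis is \<open>e, w, v\<close>.
  If not, the images of all \<open>A\<^sub>k\<close>, which lie in the common kernel, lie in that line, and any basis
  \<open>e, v, w\<close> will do.\<close>
lemma strict_triangularization:
  fixes A :: "'k::field mat list"
  assumes A: "A \<in> mat_tuples 3 m"
    and nil: "\<And>i j k. i < m \<Longrightarrow> j < m \<Longrightarrow> k < m \<Longrightarrow> A ! i * (A ! j * A ! k) = 0\<^sub>m 3 3"
  shows "\<exists>g h a b c. inverse_pair 3 g h \<and> A = conj_tuple g h (strict_upper_tuple m a b c)"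
proof -
  note Ac = nth_mat_tuples[OF A]
  have Av: "A ! i *\<^sub>v v \<in> carrier_vec 3" if "i < m" "v \<in> carrier_vec 3" for i v
    using mult_mat_vec_carrier[OF Ac] that by blast
  have A0: "A ! i *\<^sub>v 0\<^sub>v 3 = 0\<^sub>v 3" if "i < m" for i by (rule mat_mult_zero_vec[OF Ac[OF that]])
  have nilv: "A ! i *\<^sub>v (A ! j *\<^sub>v (A ! k *\<^sub>v v)) = 0\<^sub>v 3"
    if "i < m" "j < m" "k < m" "v \<in> carrier_vec 3" for i j k v
  proof -
    have "(A ! i * (A ! j * A ! k)) *\<^sub>v v = 0\<^sub>v 3" using nil that by (intro eq_vecI) auto
    then show ?thesis
      using assoc_mult_mat_vec[OF Ac[OF that(1)] mult_carrier_mat[OF Ac[OF that(2)] Ac[OF that(3)]] that(4)]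
        assoc_mult_mat_vec[OF Ac[OF that(2)] Ac[OF that(3)] that(4)] by simp
  qed
  show ?thesis
  proof (cases "\<exists>i<m. \<exists>j<m. \<exists>v \<in> carrier_vec 3. A ! i *\<^sub>v (A ! j *\<^sub>v v) \<noteq> 0\<^sub>v 3")
    case True
    then obtain i j e3 where i: "i < m" and j: "j < m" and e3: "e3 \<in> carrier_vec 3"
      and nz: "A ! i *\<^sub>v (A ! j *\<^sub>v e3) \<noteq> 0\<^sub>v 3" by blast
    define e2 where "e2 = A ! j *\<^sub>v e3"
    define e1 where "e1 = A ! i *\<^sub>v e2"
    have e2: "e2 \<in> carrier_vec 3" using Av j e3 by (simp add: e2_def)
    have e1: "e1 \<in> carrier_vec 3" using Av i e2 by (simp add: e1_def)
    have nz1: "e1 \<noteq> 0\<^sub>v 3" using nz by (simp add: e1_def e2_def)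
    have Ae1: "A ! k *\<^sub>v e1 = 0\<^sub>v 3" if "k < m" for k using nilv i j e3 that by (simp add: e1_def e2_def)
    have AAe2: "A ! k *\<^sub>v (A ! l *\<^sub>v e2) = 0\<^sub>v 3" if "k < m" "l < m" for k l
      using nilv j e3 that by (simp add: e2_def)
    have coord3: "z = 0" if "A ! i *\<^sub>v (A ! j *\<^sub>v comb3 e1 e2 e3 x y z) = 0\<^sub>v 3" for x y z
    proof -
      have "A ! i *\<^sub>v (A ! j *\<^sub>v comb3 e1 e2 e3 x y z) = comb3 (0\<^sub>v 3) (0\<^sub>v 3) e1 x y z"
        using Av[OF j] e1 e2 e3 i j
        by (simp add: mult_comb3[OF Ac] Ae1 A0 AAe2) (simp add: e1_def e2_def)
      then show ?thesis using that comb3_single_eq_zero(3)[OF e1 nz1] by metis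
    qed
    have coord2: "y = 0" if "A ! i *\<^sub>v comb3 e1 e2 e3 x y 0 = 0\<^sub>v 3" for x y
    proof -
      have "A ! i *\<^sub>v comb3 e1 e2 e3 x y 0 = comb3 (0\<^sub>v 3) e1 (A ! i *\<^sub>v e3) x y 0"
        using e1 e2 e3 i by (simp add: mult_comb3[OF Ac] Ae1 e1_def[symmetric])
      also have "\<dots> = comb3 (0\<^sub>v 3) e1 (0\<^sub>v 3) x y 0" by (auto simp: comb3_def)
      finally show ?thesis using that comb3_single_eq_zero(2)[OF e1 nz1] by metis
    qed
    have ind: "indep3 e1 e2 e3"
      unfolding indep3_def
    proof (intro conjI allI impI e1 e2 e3)
      fix x y z assume z: "comb3 e1 e2 e3 x y z = 0\<^sub>v 3"
      show z0: "z = 0" using coord3[of x y z] z A0 i j by simp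
      show y0: "y = 0" using coord2[of x y] z z0 A0 i by simp
      show "x = 0" using z comb3_single_eq_zero(4)[OF e1 nz1] by (simp add: y0 z0)
    qed
    show ?thesis
    proof (rule strict_upper_tuple_of_basis[OF A ind])
      fix k assume k: "k < m"
      obtain x y z where xyz: "A ! k *\<^sub>v e2 = comb3 e1 e2 e3 x y z"
        using indep3_expand[OF ind Av[OF k e2]] .
      have "z = 0" using coord3[of x y z] AAe2[OF j k] A0[OF i] by (simp add: xyz[symmetric])
      moreover have "y = 0" using coord2[of x y] AAe2[OF i k] xyz \<open>z = 0\<close> by simp
      ultimately have k2: "A ! k *\<^sub>v e2 = comb3 e1 e2 e3 x 0 0" using xyz by simp
      obtain x' y' z' where xyz': "A ! k *\<^sub>v e3 = comb3 e1 e2 e3 x' y' z'"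
        using indep3_expand[OF ind Av[OF k e3]] .
      have "z' = 0" using coord3[of x' y' z'] nilv[OF i j k e3] by (simp add: xyz'[symmetric])
      then have "A ! k *\<^sub>v e3 = comb3 e1 e2 e3 x' y' 0" using xyz' by simp
      then show "\<exists>a b c. A ! k *\<^sub>v e1 = 0\<^sub>v 3 \<and> A ! k *\<^sub>v e2 = comb3 e1 e2 e3 a 0 0 \<and>
          A ! k *\<^sub>v e3 = comb3 e1 e2 e3 c b 0" using Ae1[OF k] k2 by blast
    qed
  next
    case False
    then have prod0: "A ! i *\<^sub>v (A ! j *\<^sub>v v) = 0\<^sub>v 3" if "i < m" "j < m" "v \<in> carrier_vec 3" for i j v
      using that by blast
    show ?thesis
    proof (cases "\<exists>i<m. \<exists>v \<in> carrier_vec 3. A ! i *\<^sub>v v \<noteq> 0\<^sub>v 3")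
      case False
      then have "A ! i = 0\<^sub>m 3 3" if "i < m" for i using zero_mat_of_mult_vec[OF Ac[OF that]] that by blast
      then have "A = strict_upper_tuple m (\<lambda>i. 0) (\<lambda>i. 0) (\<lambda>i. 0)"
        using A by (intro nth_equalityI) (auto simp: mat_tuples_def strict_upper_def intro!: eq_matI)
      then have "A = conj_tuple (1\<^sub>m 3) (1\<^sub>m 3) (strict_upper_tuple m (\<lambda>i. 0) (\<lambda>i. 0) (\<lambda>i. 0))"
        using conj_tuple_one[of A 3 m] A by simp
      moreover have "inverse_pair 3 (1\<^sub>m 3) (1\<^sub>m 3 :: 'k mat)" by (simp add: inverse_pair_def)
      ultimately show ?thesis by blast
    next
      case True
      then obtain i v where i: "i < m" and v: "v \<in> carrier_vec 3" and nz: "A ! i *\<^sub>v v \<noteq> 0\<^sub>v 3" by blast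
      define e where "e = A ! i *\<^sub>v v"
      have e: "e \<in> carrier_vec 3" "e \<noteq> 0\<^sub>v 3" using Av[OF i v] nz by (auto simp: e_def)
      have Ae: "A ! k *\<^sub>v e = 0\<^sub>v 3" if "k < m" for k using prod0 that i v by (simp add: e_def)
      show ?thesis
      proof (cases "\<exists>w \<in> carrier_vec 3. (\<forall>k<m. A ! k *\<^sub>v w = 0\<^sub>v 3) \<and> (\<forall>x. w \<noteq> x \<cdot>\<^sub>v e)")
        case True
        then obtain w where w: "w \<in> carrier_vec 3" and Aw: "\<And>k. k < m \<Longrightarrow> A ! k *\<^sub>v w = 0\<^sub>v 3"
          and wn: "\<And>x. w \<noteq> x \<cdot>\<^sub>v e" by blast
        have coord3: "z = 0" if "A ! i *\<^sub>v comb3 e w v x y z = 0\<^sub>v 3" for x y z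
          using that e w v i comb3_single_eq_zero(3)[OF e]
          by (simp add: mult_comb3[OF Ac] Ae Aw e_def[symmetric])
        have ind: "indep3 e w v"
          unfolding indep3_def
        proof (intro conjI allI impI e w v)
          fix x y z assume z: "comb3 e w v x y z = 0\<^sub>v 3"
          show z0: "z = 0" using coord3[of x y z] z A0 i by simp
          show y0: "y = 0"
          proof (rule ccontr)
            assume nz: "y \<noteq> 0"
            have "w = (- x / y) \<cdot>\<^sub>v e"
            proof (rule eq_vecI)
              fix l assume "l < dim_vec ((- x / y) \<cdot>\<^sub>v e)"
              then have l: "l < 3" using e by simp
              have "x * e $ l + y * w $ l = 0"
                using arg_cong[OF z, of "\<lambda>t. t $ l"] l by (simp add: comb3_def z0)
              then have "y * w $ l = - (x * e $ l)" by (simp add: eq_neg_iff_add_eq_0 add.commute)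
              then show "w $ l = ((- x / y) \<cdot>\<^sub>v e) $ l" using nz l e by (simp add: field_simps)
            qed (use e w in simp)
            with wn show False by blast
          qed
          show "x = 0" using z comb3_single_eq_zero(4)[OF e] by (simp add: y0 z0)
        qed
        show ?thesis
        proof (rule strict_upper_tuple_of_basis[OF A ind])
          fix k assume k: "k < m"
          obtain x y z where xyz: "A ! k *\<^sub>v v = comb3 e w v x y z"
            using indep3_expand[OF ind Av[OF k v]] .
          have "z = 0" using coord3[of x y z] prod0[OF i k v] by (simp add: xyz[symmetric])
          then have "A ! k *\<^sub>v v = comb3 e w v x y 0" using xyz by simp
          moreover have "A ! k *\<^sub>v w = comb3 e w v 0 0 0" using Aw[OF k] by (auto simp: comb3_def)
          ultimately show "\<exists>a b c. A ! k *\<^sub>v e = 0\<^sub>v 3 \<and> A ! k *\<^sub>v w = comb3 e w v a 0 0 \<and>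
              A ! k *\<^sub>v v = comb3 e w v c b 0" using Ae[OF k] by blast
        qed
      next
        case False
        have mult_e: "\<exists>x. A ! k *\<^sub>v t = comb3 e v w x 0 0" if k: "k < m" and t: "t \<in> carrier_vec 3" for k t w
        proof -
          obtain x where x: "A ! k *\<^sub>v t = x \<cdot>\<^sub>v e" using False prod0 Av k t by blast
          have "A ! k *\<^sub>v t = comb3 e v w x 0 0" unfolding x using e by (intro eq_vecI) (auto simp: comb3_def)
          then show ?thesis ..
        qed
        define N where "N = mat 3 2 (\<lambda>(l,j). if j = 0 then e $ l else v $ l)"
        have N: "N \<in> carrier_mat 3 2" by (simp add: N_def)
        obtain w where w: "w \<in> carrier_vec 3" "\<And>c. c \<in> carrier_vec 2 \<Longrightarrow> N *\<^sub>v c \<noteq> w"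
          using tall_matrix_not_onto[OF N] by auto
        have ind: "indep3 e v w"
          unfolding indep3_def
        proof (intro conjI allI impI e v w)
          fix x y z assume z: "comb3 e v w x y z = 0\<^sub>v 3"
          show z0: "z = 0"
          proof (rule ccontr)
            assume nz: "z \<noteq> 0"
            define c where "c = vec 2 (\<lambda>j. if j = 0 then - x / z else - y / z)"
            have "N *\<^sub>v c = w"
            proof (rule eq_vecI)
              fix l assume "l < dim_vec w"
              then have l: "l < 3" using w by simp
              have "x * e $ l + y * v $ l + z * w $ l = 0"
                using arg_cong[OF z, of "\<lambda>t. t $ l"] l by (simp add: comb3_def)
              then have "z * w $ l = - (x * e $ l + y * v $ l)" by (metis minus_unique)
              moreover have "(N *\<^sub>v c) $ l = - x / z * e $ l + - y / z * v $ l"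
                using l by (simp add: N_def c_def scalar_prod_def numeral_2_eq_2 mult.commute)
              then have "z * (N *\<^sub>v c) $ l = - (x * e $ l + y * v $ l)"
                using nz by (simp add: right_diff_distrib)
              ultimately show "(N *\<^sub>v c) $ l = w $ l" using nz by (metis mult_left_cancel)
            qed (use w in \<open>simp add: N_def\<close>)
            then show False using w(2)[of c] by (simp add: c_def)
          qed
          have "A ! i *\<^sub>v comb3 e v w x y z = comb3 (0\<^sub>v 3) e (0\<^sub>v 3) x y 0"
            using e v w i by (simp add: mult_comb3[OF Ac] Ae e_def[symmetric] z0) (simp add: comb3_def)
          then show y0: "y = 0" using comb3_single_eq_zero(2)[OF e] z A0[OF i] by metis
          show "x = 0" using z comb3_single_eq_zero(4)[OF e] by (simp add: y0 z0)
        qed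
        show ?thesis
          by (rule strict_upper_tuple_of_basis[OF A ind]) (use Ae mult_e v w in blast)
      qed
    qed
  qed
qed

lemma nullcone_3_triangular:
  assumes A: "A \<in> nullcone 3 m"
  obtains g h a b c where "inverse_pair 3 g h" "A = conj_tuple g h (strict_upper_tuple m a b c)"
proof -
  have At: "A \<in> mat_tuples 3 m" using A by (simp add: nullcone_def)
  have "A ! i * (A ! j * A ! k) = 0\<^sub>m 3 3" if "i < m" "j < m" "k < m" for i j k
    using nullcone_word_zero[OF A, of "[i,j,k]"] that right_mult_one_mat[OF nth_mat_tuples[OF At that(3)]]
    by (simp add: eval_word_Cons eval_word_Nil)
  then show thesis using strict_triangularization[OF At] that by blast
qed

section \<open>Consequences of the rank inequalities\<close>

lemma hom_le_annihilator:
  fixes A B :: "'k::field mat list"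
  assumes h: "hom_le n m A B" and p: "p \<in> free_alg m" and z: "eval_free n A p = 0\<^sub>m n n"
  shows "eval_free n B p = 0\<^sub>m n n"
proof -
  define \<phi> where "\<phi> = mat 1 1 (\<lambda>_. p)"
  have \<phi>: "\<phi> \<in> carrier_mat 1 1" "elements_mat \<phi> \<subseteq> free_alg m" using p by (auto simp: \<phi>_def)
  have e: "eval_mat n X \<phi> = eval_free n X p" for X :: "'k mat list"
    by (intro eq_matI) (auto simp: eval_mat_def \<phi>_def eval_free_def)
  have "vec_space.rank (1 * n) (eval_mat n B \<phi>) \<le> vec_space.rank (1 * n) (eval_mat n A \<phi>)"
    using h \<phi> unfolding hom_le_def by blast
  then have "vec_space.rank n (eval_free n B p) = 0" unfolding e z by (simp add: vec_space.rank_0I)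
  then show ?thesis using zero_if_rank_0[OF eval_free_carrier] by blast
qed

text \<open>\<open>\<alpha> x\<^sub>k + \<beta> x\<^sub>p + \<gamma> x\<^sub>q + \<delta> x\<^sub>i x\<^sub>j + \<epsilon> x\<^sub>u x\<^sub>v\<close>. Three linear terms suffice to detect membership in
  the span of two vectors, and two quadratic terms to detect proportionality.\<close>
definition test_poly :: "'k \<Rightarrow> nat \<Rightarrow> 'k \<Rightarrow> nat \<Rightarrow> 'k \<Rightarrow> nat \<Rightarrow> 'k \<Rightarrow> nat \<Rightarrow> nat \<Rightarrow> 'k \<Rightarrow> nat \<Rightarrow> nat
    \<Rightarrow> (nat list \<Rightarrow>\<^sub>0 'k::field)" where
  "test_poly \<alpha> k \<beta> p \<gamma> q \<delta> i j \<epsilon> u v =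
     Poly_Mapping.single [k] \<alpha> + Poly_Mapping.single [p] \<beta> + Poly_Mapping.single [q] \<gamma>
     + Poly_Mapping.single [i,j] \<delta> + Poly_Mapping.single [u,v] \<epsilon>"

lemma strict_upper_mult: "strict_upper a b c * strict_upper a' b' c' = strict_upper 0 0 (a * b')"
  by (rule mat3_eqI[OF mult_carrier_mat[OF strict_upper_carrier strict_upper_carrier] strict_upper_carrier])
    (auto simp: less_3_iff mat3_mult_index[OF strict_upper_carrier strict_upper_carrier] simp del: index_mult_mat)

lemma eval_test_poly:
  assumes "k < m" "p < m" "q < m" "i < m" "j < m" "u < m" "v < m"
  shows "eval_free 3 (strict_upper_tuple m a b c) (test_poly \<alpha> k \<beta> p \<gamma> q \<delta> i j \<epsilon> u v) =
    strict_upper (\<alpha> * a k + \<beta> * a p + \<gamma> * a q) (\<alpha> * b k + \<beta> * b p + \<gamma> * b q)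
      (\<alpha> * c k + \<beta> * c p + \<gamma> * c q + \<delta> * (a i * b j) + \<epsilon> * (a u * b v))"
proof -
  have w: "eval_word 3 (strict_upper_tuple m a b c) [x] = strict_upper (a x) (b x) (c x)" if "x < m" for x
    using that right_mult_one_mat[OF strict_upper_carrier] by (simp add: eval_word_Cons eval_word_Nil)
  have ww: "eval_word 3 (strict_upper_tuple m a b c) [x,y] = strict_upper 0 0 (a x * b y)" if "x < m" "y < m" for x y
    using that w[of y] by (simp add: eval_word_Cons[of _ _ x] strict_upper_mult)
  show ?thesis
    by (rule mat3_eqI)
      (use assms in \<open>auto simp: less_3_iff test_poly_def eval_free_add_index eval_free_single_index w ww\<close>)
qed

lemma strict_upper_eq_0_iff: "strict_upper a b c = 0\<^sub>m 3 3 \<longleftrightarrow> a = 0 \<and> b = 0 \<and> c = 0"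
proof
  assume z: "strict_upper a b c = 0\<^sub>m 3 3"
  show "a = 0 \<and> b = 0 \<and> c = 0"
    using arg_cong[OF z, of "\<lambda>X. X $$ (0,1)"] arg_cong[OF z, of "\<lambda>X. X $$ (1,2)"]
      arg_cong[OF z, of "\<lambda>X. X $$ (0,2)"] by simp
qed (auto simp: strict_upper_def)

lemma hom_le_test_poly:
  assumes h: "hom_le 3 m (strict_upper_tuple m a b c) (strict_upper_tuple m a' b' c')"
    and idx: "k < m" "p < m" "q < m" "i < m" "j < m" "u < m" "v < m"
    and "\<alpha> * a k + \<beta> * a p + \<gamma> * a q = 0" "\<alpha> * b k + \<beta> * b p + \<gamma> * b q = 0"
      "\<alpha> * c k + \<beta> * c p + \<gamma> * c q + \<delta> * (a i * b j) + \<epsilon> * (a u * b v) = 0"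
  shows "\<alpha> * a' k + \<beta> * a' p + \<gamma> * a' q = 0" "\<alpha> * b' k + \<beta> * b' p + \<gamma> * b' q = 0"
    "\<alpha> * c' k + \<beta> * c' p + \<gamma> * c' q + \<delta> * (a' i * b' j) + \<epsilon> * (a' u * b' v) = 0"
proof -
  have "test_poly \<alpha> k \<beta> p \<gamma> q \<delta> i j \<epsilon> u v \<in> free_alg m"
    unfolding test_poly_def using idx by (intro free_alg_add free_alg_single) auto
  then have "eval_free 3 (strict_upper_tuple m a' b' c') (test_poly \<alpha> k \<beta> p \<gamma> q \<delta> i j \<epsilon> u v) = 0\<^sub>m 3 3"
    by (rule hom_le_annihilator[OF h]) (use assms(9-) in \<open>simp add: eval_test_poly[OF idx] strict_upper_eq_0_iff\<close>)
  then have "\<alpha> * a' k + \<beta> * a' p + \<gamma> * a' q = 0 \<and> \<alpha> * b' k + \<beta> * b' p + \<gamma> * b' q = 0 \<and>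
    \<alpha> * c' k + \<beta> * c' p + \<gamma> * c' q + \<delta> * (a' i * b' j) + \<epsilon> * (a' u * b' v) = 0"
    by (simp only: eval_test_poly[OF idx] strict_upper_eq_0_iff)
  then show "\<alpha> * a' k + \<beta> * a' p + \<gamma> * a' q = 0" "\<alpha> * b' k + \<beta> * b' p + \<gamma> * b' q = 0"
    "\<alpha> * c' k + \<beta> * c' p + \<gamma> * c' q + \<delta> * (a' i * b' j) + \<epsilon> * (a' u * b' v) = 0" by auto
qed

lemma eval_free_generator:
  assumes "A \<in> mat_tuples n m" "i < m"
  shows "eval_free n A (Poly_Mapping.single [i] 1) = A ! i"
proof -
  have "eval_word n A [i] = A ! i"
    using right_mult_one_mat[OF nth_mat_tuples[OF assms]] by (simp add: eval_word_Cons eval_word_Nil)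
  then show ?thesis using nth_mat_tuples[OF assms]
    by (intro eq_matI) (auto simp: eval_free_single_index eval_free_def[THEN arg_cong[of _ _ dim_row]] eval_free_def[THEN arg_cong[of _ _ dim_col]])
qed

text \<open>For \<open>\<phi> = (x\<^sub>p, x\<^sub>q)\<^sup>T\<close> only the last column of \<open>\<phi>(A)\<close> is nonzero, so its rank is at most 1. The
  conclusion is the vanishing of the minor of \<open>\<phi>(B)\<close> in rows \<open>0, 3\<close> (the first row of each block) and
  columns \<open>1, 2\<close>.\<close>
lemma hom_le_column_test:
  assumes h: "hom_le 3 m (strict_upper_tuple m (\<lambda>i. 0) b c) (strict_upper_tuple m a' b' c')" and pq: "p < m" "q < m"
  shows "a' p * c' q = c' p * a' q"
proof -
  define \<phi> :: "(nat list \<Rightarrow>\<^sub>0 'a) mat" where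
    "\<phi> = mat 2 1 (\<lambda>(i,j). Poly_Mapping.single [if i = 0 then p else q] 1)"
  have \<phi>: "\<phi> \<in> carrier_mat 2 1" "elements_mat \<phi> \<subseteq> free_alg m" using pq by (auto simp: \<phi>_def dest!: elements_matD intro!: free_alg_single)
  have M: "eval_mat 3 X \<phi> \<in> carrier_mat (2 * 3) (1 * 3)" for X by (rule eval_mat_carrier[OF \<phi>(1)])
  have idx: "eval_mat 3 (strict_upper_tuple m x y z) \<phi> $$ (r,s) =
      strict_upper_tuple m x y z ! (if r div 3 = 0 then p else q) $$ (r mod 3, s)" if "r < 6" "s < 3" for x y z r s
  proof -
    have "r div 3 < 2" using that by auto
    then show ?thesis using that pq eval_mat_index[OF \<phi>(1), of r 3 s]
      by (simp add: \<phi>_def eval_free_generator[OF strict_upper_tuple_in_mat_tuples])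
  qed
  let ?M = "eval_mat 3 (strict_upper_tuple m (\<lambda>i. 0) b c) \<phi>" and ?N = "eval_mat 3 (strict_upper_tuple m a' b' c') \<phi>"
  have "vec_space.rank (2 * 3) ?M \<le> 1"
  proof (rule vec_space.rank_le_1_product_entries[OF M])
    fix r s assume "r < dim_row ?M" "s < dim_col ?M"
    then have rs: "r < 6" "s < 3" using carrier_matD[OF M[of "strict_upper_tuple m (\<lambda>i. 0) b c"]] by auto
    have "r mod 3 < 3" by simp
    then show "?M $$ (r,s) = ?M $$ (r,2) * (if s = 2 then 1 else 0)"
      using rs pq unfolding less_3_iff by (auto simp: idx)
  qed
  then have "vec_space.rank (2 * 3) ?N \<le> 1" using h \<phi> unfolding hom_le_def by (meson order_trans one_le_numeral order_refl)
  from minors2_eq_if_rank_le_1[OF M this, of 0 3 1 2]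
  show ?thesis using pq by (simp add: idx)
qed

text \<open>Dually, for \<open>\<phi> = (x\<^sub>p, x\<^sub>q)\<close> only the first row of \<open>\<phi>(A)\<close> is nonzero, and the relevant minor of
  \<open>\<phi>(B)\<close> is the one in rows \<open>0, 1\<close> and columns \<open>2, 5\<close> (the last column of each block).\<close>
lemma hom_le_row_test:
  assumes h: "hom_le 3 m (strict_upper_tuple m a (\<lambda>i. 0) c) (strict_upper_tuple m a' b' c')" and pq: "p < m" "q < m"
  shows "c' p * b' q = c' q * b' p"
proof -
  define \<phi> :: "(nat list \<Rightarrow>\<^sub>0 'a) mat" where
    "\<phi> = mat 1 2 (\<lambda>(i,j). Poly_Mapping.single [if j = 0 then p else q] 1)"
  have \<phi>: "\<phi> \<in> carrier_mat 1 2" "elements_mat \<phi> \<subseteq> free_alg m" using pq by (auto simp: \<phi>_def dest!: elements_matD intro!: free_alg_single)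
  have M: "eval_mat 3 X \<phi> \<in> carrier_mat (1 * 3) (2 * 3)" for X by (rule eval_mat_carrier[OF \<phi>(1)])
  have idx: "eval_mat 3 (strict_upper_tuple m x y z) \<phi> $$ (r,s) =
      strict_upper_tuple m x y z ! (if s div 3 = 0 then p else q) $$ (r, s mod 3)" if "r < 3" "s < 6" for x y z r s
  proof -
    have "s div 3 < 2" using that by auto
    then show ?thesis using that pq eval_mat_index[OF \<phi>(1), of r 3 s]
      by (simp add: \<phi>_def eval_free_generator[OF strict_upper_tuple_in_mat_tuples])
  qed
  let ?M = "eval_mat 3 (strict_upper_tuple m a (\<lambda>i. 0) c) \<phi>" and ?N = "eval_mat 3 (strict_upper_tuple m a' b' c') \<phi>"
  have "vec_space.rank (1 * 3) ?M \<le> 1"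
  proof (rule vec_space.rank_le_1_product_entries[OF M])
    fix r s assume "r < dim_row ?M" "s < dim_col ?M"
    then have rs: "r < 3" "s < 6" using carrier_matD[OF M[of "strict_upper_tuple m a (\<lambda>i. 0) c"]] by auto
    have "s mod 3 < 3" by simp
    then show "?M $$ (r,s) = (if r = 0 then 1 else 0) * ?M $$ (0,s)"
      using rs pq unfolding less_3_iff by (auto simp: idx)
  qed
  then have "vec_space.rank (1 * 3) ?N \<le> 1" using h \<phi> unfolding hom_le_def by (meson order_trans one_le_numeral order_refl)
  from minors2_eq_if_rank_le_1[OF M this, of 0 1 2 5]
  show ?thesis using pq by (simp add: idx)
qed

section \<open>Degenerations of triangular tuples\<close>

lemma det3_nonzeroI:
  fixes g :: "'k::field mat"
  assumes g: "g \<in> carrier_mat 3 3"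
    and inj: "\<And>x y z. g $$ (0,0) * x + g $$ (0,1) * y + g $$ (0,2) * z = 0 \<Longrightarrow>
      g $$ (1,0) * x + g $$ (1,1) * y + g $$ (1,2) * z = 0 \<Longrightarrow>
      g $$ (2,0) * x + g $$ (2,1) * y + g $$ (2,2) * z = 0 \<Longrightarrow> x = 0 \<and> y = 0 \<and> z = 0"
  shows "det g \<noteq> 0"
proof
  assume "det g = 0"
  then obtain v where v: "v \<in> carrier_vec 3" "v \<noteq> 0\<^sub>v 3" "g *\<^sub>v v = 0\<^sub>v 3"
    using det_0_iff_vec_prod_zero_field[OF g] by auto
  have "g $$ (i,0) * v $ 0 + g $$ (i,1) * v $ 1 + g $$ (i,2) * v $ 2 = 0" if "i < 3" for i
    using mat3_mult_vec_index[OF g v(1) that] v(3) that by simp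
  then have "v $ 0 = 0 \<and> v $ 1 = 0 \<and> v $ 2 = 0" by (intro inj) auto
  then have "v = 0\<^sub>v 3" using v(1) by (intro eq_vecI) (auto simp: less_3_iff)
  with v(2) show False by simp
qed

lemma strict_upper_poly_entry:
  assumes "\<exists>p. \<forall>u. f u = poly p u" "\<exists>p. \<forall>u. g u = poly p u" "\<exists>p. \<forall>u. h u = poly p u" "i < 3" "j < 3"
  shows "\<exists>p. \<forall>u. strict_upper (f u) (g u) (h u) $$ (i,j) = poly p (u :: 'k::field)"
  using assms unfolding less_3_iff by (auto intro: exI[of _ 0])

text \<open>Invertible diagonal matrices scale \<open>a\<close>, \<open>b\<close>, \<open>c\<close> by \<open>s\<close>, \<open>t\<close>, \<open>s t\<close>, and unipotent matrices add multiples
  of \<open>a\<close> and \<open>b\<close> to the corner. The limit removes the condition that \<open>s\<close> and \<open>t\<close> be nonzero.\<close>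
lemma strict_upper_deg_scale:
  fixes a b c :: "nat \<Rightarrow> 'k::alg_closed_field"
  shows "deg_le 3 m (strict_upper_tuple m a b c)
    (strict_upper_tuple m (\<lambda>i. s * a i) (\<lambda>i. t * b i) (\<lambda>i. s * t * c i + x * a i + y * b i))"
proof -
  have torus: "deg_le 3 m (strict_upper_tuple m a b c)
    (strict_upper_tuple m (\<lambda>i. s * a i) (\<lambda>i. t * b i) (\<lambda>i. s * t * c i + x * a i + y * b i))"
    if st: "s \<noteq> 0" "t \<noteq> 0" for s t
  proof -
    \<comment> \<open>In the corner, \<open>A\<^sub>i h = h B\<^sub>i\<close> reads \<open>a\<^sub>i h\<^sub>1\<^sub>2 + s t c\<^sub>i = s t c\<^sub>i + x a\<^sub>i + y b\<^sub>i + h\<^sub>0\<^sub>1 t b\<^sub>i\<close>, which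
      determines the entries above the diagonal.\<close>
    define h where "h = mat 3 3 (\<lambda>(i,j). [[1, - y / t, 0], [0, s, x], [0, 0, s * t]] ! i ! j)"
    have h: "h \<in> carrier_mat 3 3" by (simp add: h_def)
    show ?thesis
    proof (rule deg_le_of_intertwiner_right[OF _ _ h])
      show "det h \<noteq> 0"
        by (rule det3_nonzeroI[OF h]) (use st in \<open>auto simp: h_def\<close>)
      fix i assume i: "i < m"
      show "strict_upper_tuple m a b c ! i * h =
        h * strict_upper_tuple m (\<lambda>i. s * a i) (\<lambda>i. t * b i) (\<lambda>i. s * t * c i + x * a i + y * b i) ! i"
        unfolding nth_strict_upper_tuple[OF i]
      proof (rule mat3_eqI[OF mult_carrier_mat[OF strict_upper_carrier h] mult_carrier_mat[OF h strict_upper_carrier]])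
        fix k l :: nat assume "k < 3" "l < 3"
        then show "(strict_upper (a i) (b i) (c i) * h) $$ (k,l) =
            (h * strict_upper (s * a i) (t * b i) (s * t * c i + x * a i + y * b i)) $$ (k,l)"
          using st unfolding mat3_mult_index[OF strict_upper_carrier h \<open>k < 3\<close> \<open>l < 3\<close>] mat3_mult_index[OF h strict_upper_carrier \<open>k < 3\<close> \<open>l < 3\<close>]
          by (auto simp: less_3_iff h_def algebra_simps)
      qed
    qed simp_all
  qed
  define G where "G u = strict_upper_tuple m (\<lambda>i. (s + u) * a i) (\<lambda>i. (t + u) * b i)
    (\<lambda>i. (s + u) * (t + u) * c i + x * a i + y * b i)" for u
  have "deg_le 3 m (strict_upper_tuple m a b c) (G 0)"
  proof (rule deg_le_limit[where G = G and q = "[:s, 1:] * [:t, 1:]"])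
    fix r i j :: nat assume r: "r < m" and ij: "i < 3" "j < 3"
    have "\<exists>p. \<forall>u. (s + u) * a r = poly p u" by (rule exI[of _ "[:s, 1:] * [:a r:]"]) (simp add: algebra_simps)
    moreover have "\<exists>p. \<forall>u. (t + u) * b r = poly p u" by (rule exI[of _ "[:t, 1:] * [:b r:]"]) (simp add: algebra_simps)
    moreover have "\<exists>p. \<forall>u. (s + u) * (t + u) * c r + x * a r + y * b r = poly p u"
      by (rule exI[of _ "[:s, 1:] * [:t, 1:] * [:c r:] + [:x * a r + y * b r:]"]) (simp add: algebra_simps)
    ultimately show "\<exists>p. \<forall>u. (G u ! r) $$ (i,j) = poly p u"
      unfolding G_def nth_strict_upper_tuple[OF r] using ij by (intro strict_upper_poly_entry)
  next
    fix u assume "poly ([:s, 1:] * [:t, 1:]) u \<noteq> 0"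
    then have "s + u \<noteq> 0" "t + u \<noteq> 0" unfolding poly_mult by auto
    then show "deg_le 3 m (strict_upper_tuple m a b c) (G u)" unfolding G_def by (rule torus)
  qed (auto simp: G_def)
  then show ?thesis by (simp add: G_def)
qed

text \<open>Invertible linear changes of the pair \<open>(b, c)\<close> come from conjugation by block matrices. An arbitrary
  change \<open>M\<close> is the limit of \<open>M + u 1\<close> for \<open>u \<rightarrow> 0\<close>, where \<open>det (M + u 1)\<close> is the polynomial
  \<open>[:\<alpha> \<delta> - \<beta> \<gamma>, \<alpha> + \<delta>, 1:]\<close> in \<open>u\<close>.\<close>
lemma strict_upper_deg_last_column:
  fixes b c :: "nat \<Rightarrow> 'k::alg_closed_field"
  shows "deg_le 3 m (strict_upper_tuple m (\<lambda>i. 0) b c)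
    (strict_upper_tuple m (\<lambda>i. 0) (\<lambda>i. \<alpha> * b i + \<beta> * c i) (\<lambda>i. \<gamma> * b i + \<delta> * c i))"
proof -
  have invertible: "deg_le 3 m (strict_upper_tuple m (\<lambda>i. 0) b c)
    (strict_upper_tuple m (\<lambda>i. 0) (\<lambda>i. \<alpha> * b i + \<beta> * c i) (\<lambda>i. \<gamma> * b i + \<delta> * c i))"
    if D: "\<alpha> * \<delta> - \<beta> * \<gamma> \<noteq> 0" for \<alpha> \<delta>
  proof -
    define g where "g = mat 3 3 (\<lambda>(i,j). [[\<delta>, \<gamma>, 0], [\<beta>, \<alpha>, 0], [0, 0, 1]] ! i ! j)"
    have g: "g \<in> carrier_mat 3 3" by (simp add: g_def)
    show ?thesis
    proof (rule deg_le_of_intertwiner_left[OF _ _ g])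
      show "det g \<noteq> 0"
      proof (rule det3_nonzeroI[OF g])
        fix x y z
        assume "g $$ (0,0) * x + g $$ (0,1) * y + g $$ (0,2) * z = 0"
          "g $$ (1,0) * x + g $$ (1,1) * y + g $$ (1,2) * z = 0"
          "g $$ (2,0) * x + g $$ (2,1) * y + g $$ (2,2) * z = 0"
        then have e: "\<delta> * x + \<gamma> * y = 0" "\<beta> * x + \<alpha> * y = 0" "z = 0"
          by (simp_all add: g_def)
        have "(\<alpha> * \<delta> - \<beta> * \<gamma>) * x = \<alpha> * (\<delta> * x + \<gamma> * y) - \<gamma> * (\<beta> * x + \<alpha> * y)"
          "(\<alpha> * \<delta> - \<beta> * \<gamma>) * y = \<delta> * (\<beta> * x + \<alpha> * y) - \<beta> * (\<delta> * x + \<gamma> * y)"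
          by (simp_all add: algebra_simps)
        then show "x = 0 \<and> y = 0 \<and> z = 0" using D e by simp
      qed
      fix i assume i: "i < m"
      show "g * strict_upper_tuple m (\<lambda>i. 0) b c ! i =
        strict_upper_tuple m (\<lambda>i. 0) (\<lambda>i. \<alpha> * b i + \<beta> * c i) (\<lambda>i. \<gamma> * b i + \<delta> * c i) ! i * g"
        unfolding nth_strict_upper_tuple[OF i]
      proof (rule mat3_eqI[OF mult_carrier_mat[OF g strict_upper_carrier] mult_carrier_mat[OF strict_upper_carrier g]])
        fix k l :: nat assume "k < 3" "l < 3"
        then show "(g * strict_upper 0 (b i) (c i)) $$ (k,l) =
            (strict_upper 0 (\<alpha> * b i + \<beta> * c i) (\<gamma> * b i + \<delta> * c i) * g) $$ (k,l)"
          unfolding mat3_mult_index[OF strict_upper_carrier g \<open>k < 3\<close> \<open>l < 3\<close>] mat3_mult_index[OF g strict_upper_carrier \<open>k < 3\<close> \<open>l < 3\<close>]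
          by (auto simp: less_3_iff g_def)
      qed
    qed simp_all
  qed
  define G where "G u = strict_upper_tuple m (\<lambda>i. 0) (\<lambda>i. (\<alpha> + u) * b i + \<beta> * c i)
    (\<lambda>i. \<gamma> * b i + (\<delta> + u) * c i)" for u
  have "deg_le 3 m (strict_upper_tuple m (\<lambda>i. 0) b c) (G 0)"
  proof (rule deg_le_limit[where G = G and q = "[:\<alpha> * \<delta> - \<beta> * \<gamma>, \<alpha> + \<delta>, 1:]"])
    fix r i j :: nat assume r: "r < m" and ij: "i < 3" "j < 3"
    have "\<exists>p. \<forall>u. (0 :: 'k) = poly p u" by (rule exI[of _ 0]) simp
    moreover have "\<exists>p. \<forall>u. (\<alpha> + u) * b r + \<beta> * c r = poly p u"
      by (rule exI[of _ "[:\<alpha> * b r + \<beta> * c r, b r:]"]) (simp add: algebra_simps)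
    moreover have "\<exists>p. \<forall>u. \<gamma> * b r + (\<delta> + u) * c r = poly p u"
      by (rule exI[of _ "[:\<gamma> * b r + \<delta> * c r, c r:]"]) (simp add: algebra_simps)
    ultimately show "\<exists>p. \<forall>u. (G u ! r) $$ (i,j) = poly p u"
      unfolding G_def nth_strict_upper_tuple[OF r] using ij by (intro strict_upper_poly_entry)
  next
    fix u assume "poly [:\<alpha> * \<delta> - \<beta> * \<gamma>, \<alpha> + \<delta>, 1:] u \<noteq> 0"
    then show "deg_le 3 m (strict_upper_tuple m (\<lambda>i. 0) b c) (G u)"
      unfolding G_def by (intro invertible) (simp add: algebra_simps)
  qed (auto simp: G_def)
  then show ?thesis by (simp add: G_def)
qed

text \<open>The same for the pair \<open>(a, c)\<close> when \<open>b = 0\<close>.\<close>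
lemma strict_upper_deg_first_row:
  fixes a c :: "nat \<Rightarrow> 'k::alg_closed_field"
  shows "deg_le 3 m (strict_upper_tuple m a (\<lambda>i. 0) c)
    (strict_upper_tuple m (\<lambda>i. \<alpha> * a i + \<beta> * c i) (\<lambda>i. 0) (\<lambda>i. \<gamma> * a i + \<delta> * c i))"
proof -
  have invertible: "deg_le 3 m (strict_upper_tuple m a (\<lambda>i. 0) c)
    (strict_upper_tuple m (\<lambda>i. \<alpha> * a i + \<beta> * c i) (\<lambda>i. 0) (\<lambda>i. \<gamma> * a i + \<delta> * c i))"
    if D: "\<alpha> * \<delta> - \<beta> * \<gamma> \<noteq> 0" for \<alpha> \<delta>
  proof -
    define h where "h = mat 3 3 (\<lambda>(i,j). [[1, 0, 0], [0, \<alpha>, \<gamma>], [0, \<beta>, \<delta>]] ! i ! j)"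
    have h: "h \<in> carrier_mat 3 3" by (simp add: h_def)
    show ?thesis
    proof (rule deg_le_of_intertwiner_right[OF _ _ h])
      show "det h \<noteq> 0"
      proof (rule det3_nonzeroI[OF h])
        fix x y z
        assume "h $$ (0,0) * x + h $$ (0,1) * y + h $$ (0,2) * z = 0"
          "h $$ (1,0) * x + h $$ (1,1) * y + h $$ (1,2) * z = 0"
          "h $$ (2,0) * x + h $$ (2,1) * y + h $$ (2,2) * z = 0"
        then have e: "\<alpha> * y + \<gamma> * z = 0" "\<beta> * y + \<delta> * z = 0" "x = 0"
          by (simp_all add: h_def)
        have "(\<alpha> * \<delta> - \<beta> * \<gamma>) * y = \<delta> * (\<alpha> * y + \<gamma> * z) - \<gamma> * (\<beta> * y + \<delta> * z)"
          "(\<alpha> * \<delta> - \<beta> * \<gamma>) * z = \<alpha> * (\<beta> * y + \<delta> * z) - \<beta> * (\<alpha> * y + \<gamma> * z)"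
          by (simp_all add: algebra_simps)
        then show "x = 0 \<and> y = 0 \<and> z = 0" using D e by simp
      qed
      fix i assume i: "i < m"
      show "strict_upper_tuple m a (\<lambda>i. 0) c ! i * h =
        h * strict_upper_tuple m (\<lambda>i. \<alpha> * a i + \<beta> * c i) (\<lambda>i. 0) (\<lambda>i. \<gamma> * a i + \<delta> * c i) ! i"
        unfolding nth_strict_upper_tuple[OF i]
      proof (rule mat3_eqI[OF mult_carrier_mat[OF strict_upper_carrier h] mult_carrier_mat[OF h strict_upper_carrier]])
        fix k l :: nat assume "k < 3" "l < 3"
        then show "(strict_upper (a i) 0 (c i) * h) $$ (k,l) =
            (h * strict_upper (\<alpha> * a i + \<beta> * c i) 0 (\<gamma> * a i + \<delta> * c i)) $$ (k,l)"
          unfolding mat3_mult_index[OF strict_upper_carrier h \<open>k < 3\<close> \<open>l < 3\<close>] mat3_mult_index[OF h strict_upper_carrier \<open>k < 3\<close> \<open>l < 3\<close>]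
          by (auto simp: less_3_iff h_def mult.commute)
      qed
    qed simp_all
  qed
  define G where "G u = strict_upper_tuple m (\<lambda>i. (\<alpha> + u) * a i + \<beta> * c i) (\<lambda>i. 0)
    (\<lambda>i. \<gamma> * a i + (\<delta> + u) * c i)" for u
  have "deg_le 3 m (strict_upper_tuple m a (\<lambda>i. 0) c) (G 0)"
  proof (rule deg_le_limit[where G = G and q = "[:\<alpha> * \<delta> - \<beta> * \<gamma>, \<alpha> + \<delta>, 1:]"])
    fix r i j :: nat assume r: "r < m" and ij: "i < 3" "j < 3"
    have "\<exists>p. \<forall>u. (0 :: 'k) = poly p u" by (rule exI[of _ 0]) simp
    moreover have "\<exists>p. \<forall>u. (\<alpha> + u) * a r + \<beta> * c r = poly p u"
      by (rule exI[of _ "[:\<alpha> * a r + \<beta> * c r, a r:]"]) (simp add: algebra_simps)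
    moreover have "\<exists>p. \<forall>u. \<gamma> * a r + (\<delta> + u) * c r = poly p u"
      by (rule exI[of _ "[:\<gamma> * a r + \<delta> * c r, c r:]"]) (simp add: algebra_simps)
    ultimately show "\<exists>p. \<forall>u. (G u ! r) $$ (i,j) = poly p u"
      unfolding G_def nth_strict_upper_tuple[OF r] using ij by (intro strict_upper_poly_entry)
  next
    fix u assume "poly [:\<alpha> * \<delta> - \<beta> * \<gamma>, \<alpha> + \<delta>, 1:] u \<noteq> 0"
    then show "deg_le 3 m (strict_upper_tuple m a (\<lambda>i. 0) c) (G u)"
      unfolding G_def by (intro invertible) (simp add: algebra_simps)
  qed (auto simp: G_def)
  then show ?thesis by (simp add: G_def)
qed

section \<open>The rank inequalities imply degeneration\<close>

text \<open>The double annihilator of two vectors of \<open>K\<^sup>m\<close> is their span. Linear forms supported on three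
  coordinates are enough: once \<open>p, q\<close> carry a nonzero minor \<open>a\<^sub>p b\<^sub>q - a\<^sub>q b\<^sub>p\<close>, Cramer's rule for the
  coordinates \<open>k, p, q\<close> expresses \<open>c\<^sub>k\<close> with coefficients that do not depend on \<open>k\<close>.\<close>
lemma span_of_two_by_three_term_relations:
  fixes a b c :: "nat \<Rightarrow> 'k::field"
  assumes rel: "\<And>k p q \<alpha> \<beta> \<gamma>. k < m \<Longrightarrow> p < m \<Longrightarrow> q < m \<Longrightarrow>
      \<alpha> * a k + \<beta> * a p + \<gamma> * a q = 0 \<Longrightarrow> \<alpha> * b k + \<beta> * b p + \<gamma> * b q = 0 \<Longrightarrow>
      \<alpha> * c k + \<beta> * c p + \<gamma> * c q = 0"
  shows "\<exists>x y. \<forall>k<m. c k = x * a k + y * b k"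
proof (cases "\<exists>p<m. \<exists>q<m. a p * b q - a q * b p \<noteq> 0")
  case True
  then obtain p q where pq: "p < m" "q < m" and D: "a p * b q - a q * b p \<noteq> 0" by blast
  define D' where "D' = a p * b q - a q * b p"
  have "c k = (b q * c p - b p * c q) / D' * a k + (a p * c q - a q * c p) / D' * b k" if k: "k < m" for k
  proof -
    \<comment> \<open>The coefficients are the signed minors of the \<open>2 \<times> 3\<close> matrix with rows \<open>a, b\<close> and columns \<open>k, p, q\<close>.\<close>
    have "D' * c k + - (a k * b q - a q * b k) * c p + - (a p * b k - a k * b p) * c q = 0"
      by (rule rel[OF k pq]; unfold D'_def; simp add: algebra_simps)
    moreover have "D' * c k - ((b q * c p - b p * c q) * a k + (a p * c q - a q * c p) * b k) =
        D' * c k + - (a k * b q - a q * b k) * c p + - (a p * b k - a k * b p) * c q"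
      by (simp add: algebra_simps)
    ultimately have "D' * c k = (b q * c p - b p * c q) * a k + (a p * c q - a q * c p) * b k" by simp
    moreover have "D' \<noteq> 0" using D by (simp add: D'_def)
    ultimately have "c k = ((b q * c p - b p * c q) * a k + (a p * c q - a q * c p) * b k) / D'"
      by (metis nonzero_mult_div_cancel_left)
    then show ?thesis by (simp add: add_divide_distrib)
  qed
  then show ?thesis by blast
next
  case False
  then have D0: "a p * b q = a q * b p" if "p < m" "q < m" for p q using that by auto
  show ?thesis
  proof (cases "\<exists>p<m. a p \<noteq> 0")
    case True
    then obtain p where p: "p < m" "a p \<noteq> 0" by blast
    have "c k = c p / a p * a k + 0 * b k" if k: "k < m" for k
      using rel[OF k p(1) p(1), of "a p" "- a k" 0] D0[OF p(1) k] p(2) by (simp add: field_simps)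
    then show ?thesis by blast
  next
    case False
    then have a0: "a k = 0" if "k < m" for k using that by blast
    show ?thesis
    proof (cases "\<exists>p<m. b p \<noteq> 0")
      case True
      then obtain p where p: "p < m" "b p \<noteq> 0" by blast
      have "c k = 0 * a k + c p / b p * b k" if k: "k < m" for k
        using rel[OF k p(1) p(1), of "b p" "- b k" 0] a0 k p by (simp add: field_simps)
      then show ?thesis by blast
    next
      case False
      then have "c k = 0 * a k + 0 * b k" if "k < m" for k
        using rel[OF that that that, of 1 0 0] a0 that by simp
      then show ?thesis by blast
    qed
  qed
qed

lemma strict_upper_tuple_cong:
  assumes "\<And>i. i < m \<Longrightarrow> a i = a' i \<and> b i = b' i \<and> c i = c' i"
  shows "strict_upper_tuple m a b c = strict_upper_tuple m a' b' c'"
  using assms by (simp add: strict_upper_tuple_def)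

text \<open>Let \<open>\<lambda>\<close> be a linear form with \<open>\<lambda>(a) = \<lambda>(b) = 0\<close>. Then \<open>\<lambda>(A)\<close> has the corner entry \<open>\<lambda>(c)\<close> only, so
  it is a multiple of \<open>A\<^sub>i A\<^sub>j\<close>. The same relation at \<open>B\<close> says that \<open>\<lambda>\<close> kills \<open>a'\<close> and \<open>b'\<close> and relates
  \<open>\<lambda>(c')\<close> to \<open>\<lambda>(c)\<close>.\<close>
lemma hom_le_imp_deg_le_uniserial:
  fixes a b c :: "nat \<Rightarrow> 'k::alg_closed_field"
  assumes h: "hom_le 3 m (strict_upper_tuple m a b c) (strict_upper_tuple m a' b' c')"
    and i: "i < m" "a i \<noteq> 0" and j: "j < m" "b j \<noteq> 0"
  shows "deg_le 3 m (strict_upper_tuple m a b c) (strict_upper_tuple m a' b' c')"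
proof -
  let ?T = "deg_le 3 m (strict_upper_tuple m a b c)"
  have rel: "\<alpha> * a' k + \<beta> * a' p + \<gamma> * a' q = 0" "\<alpha> * b' k + \<beta> * b' p + \<gamma> * b' q = 0"
    "\<alpha> * c' k + \<beta> * c' p + \<gamma> * c' q = (\<alpha> * c k + \<beta> * c p + \<gamma> * c q) / (a i * b j) * (a' i * b' j)"
    if "k < m" "p < m" "q < m" "\<alpha> * a k + \<beta> * a p + \<gamma> * a q = 0" "\<alpha> * b k + \<beta> * b p + \<gamma> * b q = 0"
    for k p q \<alpha> \<beta> \<gamma>
  proof -
    \<comment> \<open>The multiple of \<open>x\<^sub>i x\<^sub>j\<close> that cancels the corner of the linear part at \<open>A\<close>.\<close>
    let ?\<delta> = "- ((\<alpha> * c k + \<beta> * c p + \<gamma> * c q) / (a i * b j))"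
    have z: "\<alpha> * c k + \<beta> * c p + \<gamma> * c q + ?\<delta> * (a i * b j) + 0 * (a i * b j) = 0"
      using i j by simp
    note r = hom_le_test_poly[OF h that(1-3) i(1) j(1) i(1) j(1) that(4,5) z]
    show "\<alpha> * a' k + \<beta> * a' p + \<gamma> * a' q = 0" "\<alpha> * b' k + \<beta> * b' p + \<gamma> * b' q = 0" by (fact r)+
    show "\<alpha> * c' k + \<beta> * c' p + \<gamma> * c' q = (\<alpha> * c k + \<beta> * c p + \<gamma> * c q) / (a i * b j) * (a' i * b' j)"
      using r(3) by simp
  qed
  have span_a: "\<exists>x y. \<forall>k<m. a' k = x * a k + y * b k"
    by (rule span_of_two_by_three_term_relations) (rule rel(1))
  have span_b: "\<exists>x y. \<forall>k<m. b' k = x * a k + y * b k"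
    by (rule span_of_two_by_three_term_relations) (rule rel(2))
  show ?thesis
  proof (cases "(\<exists>i'<m. a' i' \<noteq> 0) \<and> (\<exists>j'<m. b' j' \<noteq> 0)")
    case True
    then obtain i' j' where i': "i' < m" "a' i' \<noteq> 0" and j': "j' < m" "b' j' \<noteq> 0" by blast
    define s t where "s = a' i / a i" and "t = b' j / b j"
    have a': "a' k = s * a k" if k: "k < m" for k
    proof -
      \<comment> \<open>The polynomial \<open>a\<^sub>i x\<^sub>k x\<^bsub>j'\<^esub> - a\<^sub>k x\<^sub>i x\<^bsub>j'\<^esub>\<close> vanishes at \<open>A\<close>.\<close>
      have "0 * c' k + 0 * c' k + 0 * c' k + a i * (a' k * b' j') + - a k * (a' i * b' j') = 0"
        by (rule hom_le_test_poly(3)[OF h k k k k j'(1) i(1) j'(1)]) auto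
      then have "(a i * a' k - a k * a' i) * b' j' = 0" by (simp add: algebra_simps)
      then show ?thesis using i j' by (simp add: s_def field_simps)
    qed
    have b': "b' k = t * b k" if k: "k < m" for k
    proof -
      \<comment> \<open>The polynomial \<open>b\<^sub>j x\<^bsub>i'\<^esub> x\<^sub>k - b\<^sub>k x\<^bsub>i'\<^esub> x\<^sub>j\<close> vanishes at \<open>A\<close>.\<close>
      have "0 * c' k + 0 * c' k + 0 * c' k + b j * (a' i' * b' k) + - b k * (a' i' * b' j) = 0"
        by (rule hom_le_test_poly(3)[OF h k k k i'(1) k i'(1) j(1)]) auto
      then have "(b j * b' k - b k * b' j) * a' i' = 0" by (simp add: algebra_simps)
      then show ?thesis using j i' by (simp add: t_def field_simps)
    qed
    have "\<exists>x y. \<forall>k<m. c' k - s * t * c k = x * a k + y * b k"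
    proof (rule span_of_two_by_three_term_relations)
      fix k p q \<alpha> \<beta> \<gamma>
      assume kpq: "k < m" "p < m" "q < m" and "\<alpha> * a k + \<beta> * a p + \<gamma> * a q = 0" "\<alpha> * b k + \<beta> * b p + \<gamma> * b q = 0"
      then have "\<alpha> * c' k + \<beta> * c' p + \<gamma> * c' q = (\<alpha> * c k + \<beta> * c p + \<gamma> * c q) / (a i * b j) * (a' i * b' j)"
        by (rule rel(3))
      also have "\<dots> = (\<alpha> * c k + \<beta> * c p + \<gamma> * c q) * (s * t)" by (simp add: s_def t_def)
      finally show "\<alpha> * (c' k - s * t * c k) + \<beta> * (c' p - s * t * c p) + \<gamma> * (c' q - s * t * c q) = 0"
        by (simp add: algebra_simps)
    qed
    then obtain x y where xy: "\<And>k. k < m \<Longrightarrow> c' k - s * t * c k = x * a k + y * b k" by blast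
    have "strict_upper_tuple m a' b' c' =
        strict_upper_tuple m (\<lambda>i. s * a i) (\<lambda>i. t * b i) (\<lambda>i. s * t * c i + x * a i + y * b i)"
      by (rule strict_upper_tuple_cong) (use a' b' xy in \<open>auto simp: algebra_simps\<close>)
    then show ?thesis using strict_upper_deg_scale by simp
  next
    case False
    have "a' i * b' j = 0" using False i(1) j(1) by auto
    then have "\<exists>x y. \<forall>k<m. c' k = x * a k + y * b k"
      using rel(3) by (intro span_of_two_by_three_term_relations) simp
    then obtain x y where c': "\<And>k. k < m \<Longrightarrow> c' k = x * a k + y * b k" by blast
    show ?thesis
    proof (cases "\<exists>i'<m. a' i' \<noteq> 0")
      case False
      obtain x' y' where b': "\<And>k. k < m \<Longrightarrow> b' k = x' * a k + y' * b k" using span_b by blast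
      have "?T (strict_upper_tuple m (\<lambda>i. 0) b a)" using strict_upper_deg_scale[of m a b c 0 1 1 0] by simp
      moreover have "deg_le 3 m (strict_upper_tuple m (\<lambda>i. 0) b a)
          (strict_upper_tuple m (\<lambda>i. 0) (\<lambda>i. y' * b i + x' * a i) (\<lambda>i. y * b i + x * a i))"
        by (rule strict_upper_deg_last_column)
      moreover have "strict_upper_tuple m a' b' c' =
          strict_upper_tuple m (\<lambda>i. 0) (\<lambda>i. y' * b i + x' * a i) (\<lambda>i. y * b i + x * a i)"
        by (rule strict_upper_tuple_cong) (use False b' c' in \<open>auto simp: add.commute\<close>)
      ultimately show ?thesis using deg_le_trans[OF strict_upper_tuple_in_mat_tuples] by simp
    next
      case True
      then have b'0: "b' k = 0" if "k < m" for k
        using that \<open>\<not> ((\<exists>i'<m. a' i' \<noteq> 0) \<and> (\<exists>j'<m. b' j' \<noteq> 0))\<close> by blast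
      obtain x' y' where a': "\<And>k. k < m \<Longrightarrow> a' k = x' * a k + y' * b k" using span_a by blast
      have "?T (strict_upper_tuple m a (\<lambda>i. 0) b)" using strict_upper_deg_scale[of m a b c 1 0 0 1] by simp
      moreover have "deg_le 3 m (strict_upper_tuple m a (\<lambda>i. 0) b)
          (strict_upper_tuple m (\<lambda>i. x' * a i + y' * b i) (\<lambda>i. 0) (\<lambda>i. x * a i + y * b i))"
        by (rule strict_upper_deg_first_row)
      moreover have "strict_upper_tuple m a' b' c' =
          strict_upper_tuple m (\<lambda>i. x' * a i + y' * b i) (\<lambda>i. 0) (\<lambda>i. x * a i + y * b i)"
        by (rule strict_upper_tuple_cong) (use b'0 a' c' in auto)
      ultimately show ?thesis using deg_le_trans[OF strict_upper_tuple_in_mat_tuples] by simp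
    qed
  qed
qed

text \<open>If \<open>a' \<noteq> 0\<close>, the path from \<open>A\<close> to \<open>B\<close> passes through the tuple with corner \<open>a'\<close> and zeros elsewhere:
  it lies both in the last column and in the first row.\<close>
lemma hom_le_imp_deg_le_last_column:
  fixes b c :: "nat \<Rightarrow> 'k::alg_closed_field"
  assumes h: "hom_le 3 m (strict_upper_tuple m (\<lambda>i. 0) b c) (strict_upper_tuple m a' b' c')"
  shows "deg_le 3 m (strict_upper_tuple m (\<lambda>i. 0) b c) (strict_upper_tuple m a' b' c')"
proof -
  let ?T = "deg_le 3 m (strict_upper_tuple m (\<lambda>i. 0) b c)"
  have prod0: "a' i * b' j = 0" if "i < m" "j < m" for i j
  proof -
    have "0 * c' i + 0 * c' i + 0 * c' i + 1 * (a' i * b' j) + 0 * (a' i * b' j) = 0"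
      by (rule hom_le_test_poly(3)[OF h that(1) that(1) that(1) that that]) auto
    then show ?thesis by simp
  qed
  have rel: "\<alpha> * a' k + \<beta> * a' p + \<gamma> * a' q = 0" "\<alpha> * b' k + \<beta> * b' p + \<gamma> * b' q = 0"
    "\<alpha> * c' k + \<beta> * c' p + \<gamma> * c' q = 0"
    if "k < m" "p < m" "q < m" "\<alpha> * b k + \<beta> * b p + \<gamma> * b q = 0" "\<alpha> * c k + \<beta> * c p + \<gamma> * c q = 0"
    for k p q \<alpha> \<beta> \<gamma>
    using hom_le_test_poly[OF h that(1-3) that(1) that(1) that(1) that(1), of \<alpha> \<beta> \<gamma> 0 0] that(4,5) by auto
  obtain x y where a': "\<And>k. k < m \<Longrightarrow> a' k = x * b k + y * c k"
    using span_of_two_by_three_term_relations[of m b c a'] rel(1) by blast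
  obtain x1 y1 where b': "\<And>k. k < m \<Longrightarrow> b' k = x1 * b k + y1 * c k"
    using span_of_two_by_three_term_relations[of m b c b'] rel(2) by blast
  obtain x2 y2 where c': "\<And>k. k < m \<Longrightarrow> c' k = x2 * b k + y2 * c k"
    using span_of_two_by_three_term_relations[of m b c c'] rel(3) by blast
  show ?thesis
  proof (cases "\<exists>p<m. a' p \<noteq> 0")
    case False
    have "strict_upper_tuple m a' b' c' =
        strict_upper_tuple m (\<lambda>i. 0) (\<lambda>i. x1 * b i + y1 * c i) (\<lambda>i. x2 * b i + y2 * c i)"
      by (rule strict_upper_tuple_cong) (use False b' c' in auto)
    then show ?thesis using strict_upper_deg_last_column by simp
  next
    case True
    then obtain p where p: "p < m" "a' p \<noteq> 0" by blast
    have b'0: "b' k = 0" if "k < m" for k using prod0[OF p(1) that] p(2) by simp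
    have c'r: "c' k = c' p / a' p * a' k" if "k < m" for k
      using hom_le_column_test[OF h p(1) that] p(2) by (simp add: field_simps)
    have "strict_upper_tuple m (\<lambda>i. 0) (\<lambda>i. 0) a' = strict_upper_tuple m (\<lambda>i. 0) (\<lambda>i. 0 * b i + 0 * c i) (\<lambda>i. x * b i + y * c i)"
      by (rule strict_upper_tuple_cong) (use a' in auto)
    then have "?T (strict_upper_tuple m (\<lambda>i. 0) (\<lambda>i. 0) a')" using strict_upper_deg_last_column[of m b c 0 0 x y] by simp
    moreover have "deg_le 3 m (strict_upper_tuple m (\<lambda>i. 0) (\<lambda>i. 0) a')
        (strict_upper_tuple m (\<lambda>i. 0 * 0 + 1 * a' i) (\<lambda>i. 0) (\<lambda>i. 0 * 0 + c' p / a' p * a' i))"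
      by (rule strict_upper_deg_first_row)
    moreover have "strict_upper_tuple m a' b' c' =
        strict_upper_tuple m (\<lambda>i. 0 * 0 + 1 * a' i) (\<lambda>i. 0) (\<lambda>i. 0 * 0 + c' p / a' p * a' i)"
      by (rule strict_upper_tuple_cong) (use b'0 c'r in auto)
    ultimately show ?thesis using deg_le_trans[OF strict_upper_tuple_in_mat_tuples] by simp
  qed
qed

lemma hom_le_imp_deg_le_first_row:
  fixes a c :: "nat \<Rightarrow> 'k::alg_closed_field"
  assumes h: "hom_le 3 m (strict_upper_tuple m a (\<lambda>i. 0) c) (strict_upper_tuple m a' b' c')"
  shows "deg_le 3 m (strict_upper_tuple m a (\<lambda>i. 0) c) (strict_upper_tuple m a' b' c')"
proof -
  let ?T = "deg_le 3 m (strict_upper_tuple m a (\<lambda>i. 0) c)"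
  have prod0: "a' i * b' j = 0" if "i < m" "j < m" for i j
  proof -
    have "0 * c' i + 0 * c' i + 0 * c' i + 1 * (a' i * b' j) + 0 * (a' i * b' j) = 0"
      by (rule hom_le_test_poly(3)[OF h that(1) that(1) that(1) that that]) auto
    then show ?thesis by simp
  qed
  have rel: "\<alpha> * a' k + \<beta> * a' p + \<gamma> * a' q = 0" "\<alpha> * b' k + \<beta> * b' p + \<gamma> * b' q = 0"
    "\<alpha> * c' k + \<beta> * c' p + \<gamma> * c' q = 0"
    if "k < m" "p < m" "q < m" "\<alpha> * a k + \<beta> * a p + \<gamma> * a q = 0" "\<alpha> * c k + \<beta> * c p + \<gamma> * c q = 0"
    for k p q \<alpha> \<beta> \<gamma>
    using hom_le_test_poly[OF h that(1-3) that(1) that(1) that(1) that(1), of \<alpha> \<beta> \<gamma> 0 0] that(4,5) by auto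
  obtain x y where b': "\<And>k. k < m \<Longrightarrow> b' k = x * a k + y * c k"
    using span_of_two_by_three_term_relations[of m a c b'] rel(2) by blast
  obtain x1 y1 where a': "\<And>k. k < m \<Longrightarrow> a' k = x1 * a k + y1 * c k"
    using span_of_two_by_three_term_relations[of m a c a'] rel(1) by blast
  obtain x2 y2 where c': "\<And>k. k < m \<Longrightarrow> c' k = x2 * a k + y2 * c k"
    using span_of_two_by_three_term_relations[of m a c c'] rel(3) by blast
  show ?thesis
  proof (cases "\<exists>p<m. b' p \<noteq> 0")
    case False
    have "strict_upper_tuple m a' b' c' =
        strict_upper_tuple m (\<lambda>i. x1 * a i + y1 * c i) (\<lambda>i. 0) (\<lambda>i. x2 * a i + y2 * c i)"
      by (rule strict_upper_tuple_cong) (use False a' c' in auto)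
    then show ?thesis using strict_upper_deg_first_row by simp
  next
    case True
    then obtain p where p: "p < m" "b' p \<noteq> 0" by blast
    have a'0: "a' k = 0" if "k < m" for k using prod0[OF that p(1)] p(2) by simp
    have c'r: "c' k = c' p / b' p * b' k" if "k < m" for k
      using hom_le_row_test[OF h p(1) that] p(2) by (simp add: field_simps)
    have "strict_upper_tuple m (\<lambda>i. 0) (\<lambda>i. 0) b' = strict_upper_tuple m (\<lambda>i. 0 * a i + 0 * c i) (\<lambda>i. 0) (\<lambda>i. x * a i + y * c i)"
      by (rule strict_upper_tuple_cong) (use b' in auto)
    then have "?T (strict_upper_tuple m (\<lambda>i. 0) (\<lambda>i. 0) b')" using strict_upper_deg_first_row[of m a c 0 0 x y] by simp
    moreover have "deg_le 3 m (strict_upper_tuple m (\<lambda>i. 0) (\<lambda>i. 0) b')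
        (strict_upper_tuple m (\<lambda>i. 0) (\<lambda>i. 0 * 0 + 1 * b' i) (\<lambda>i. 0 * 0 + c' p / b' p * b' i))"
      by (rule strict_upper_deg_last_column)
    moreover have "strict_upper_tuple m a' b' c' =
        strict_upper_tuple m (\<lambda>i. 0) (\<lambda>i. 0 * 0 + 1 * b' i) (\<lambda>i. 0 * 0 + c' p / b' p * b' i)"
      by (rule strict_upper_tuple_cong) (use a'0 c'r in auto)
    ultimately show ?thesis using deg_le_trans[OF strict_upper_tuple_in_mat_tuples] by simp
  qed
qed

lemma hom_le_imp_deg_le_strict_upper:
  fixes a b c :: "nat \<Rightarrow> 'k::alg_closed_field"
  assumes h: "hom_le 3 m (strict_upper_tuple m a b c) (strict_upper_tuple m a' b' c')"
  shows "deg_le 3 m (strict_upper_tuple m a b c) (strict_upper_tuple m a' b' c')"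
proof -
  consider "\<forall>i<m. a i = 0" | "\<forall>i<m. b i = 0" | i j where "i < m" "a i \<noteq> 0" "j < m" "b j \<noteq> 0" by blast
  then show ?thesis
  proof cases
    case 1
    then have "strict_upper_tuple m a b c = strict_upper_tuple m (\<lambda>i. 0) b c" by (intro strict_upper_tuple_cong) auto
    then show ?thesis using h hom_le_imp_deg_le_last_column by simp
  next
    case 2
    then have "strict_upper_tuple m a b c = strict_upper_tuple m a (\<lambda>i. 0) c" by (intro strict_upper_tuple_cong) auto
    then show ?thesis using h hom_le_imp_deg_le_first_row by simp
  next
    case 3
    then show ?thesis using h hom_le_imp_deg_le_uniserial by blast
  qed
qed

theorem theorem1p2:
  fixes m :: nat and A B :: "'k::alg_closed_field mat list"
  assumes "m \<ge> 1"
    and "A \<in> nullcone 3 m" and "B \<in> nullcone 3 m"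
  shows "deg_le 3 m A B \<longleftrightarrow> hom_le 3 m A B"
proof
  have A: "A \<in> mat_tuples 3 m" and B: "B \<in> mat_tuples 3 m"
    using assms by (simp_all add: nullcone_def)
  show "hom_le 3 m A B" if "deg_le 3 m A B" using deg_le_imp_hom_le[OF A that] .
  assume h: "hom_le 3 m A B"
  obtain g h a b c where gh: "inverse_pair 3 g h" and Ag: "A = conj_tuple g h (strict_upper_tuple m a b c)"
    using nullcone_3_triangular[OF assms(2)] .
  obtain g' h' a' b' c' where gh': "inverse_pair 3 g' h'" and Bg: "B = conj_tuple g' h' (strict_upper_tuple m a' b' c')"
    using nullcone_3_triangular[OF assms(3)] .
  let ?A = "strict_upper_tuple m a b c" and ?B = "strict_upper_tuple m a' b' c'"
  have dA: "deg_le 3 m ?A A" "deg_le 3 m A ?A" and dB: "deg_le 3 m ?B B" "deg_le 3 m B ?B"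
    using deg_le_conj_tuple[OF strict_upper_tuple_in_mat_tuples] gh gh' Ag Bg by blast+
  have "hom_le 3 m ?A A" "hom_le 3 m B ?B"
    using deg_le_imp_hom_le[OF strict_upper_tuple_in_mat_tuples dA(1)] deg_le_imp_hom_le[OF B dB(2)] by auto
  then have "hom_le 3 m ?A ?B" using h hom_le_trans by blast
  then have "deg_le 3 m ?A ?B" by (rule hom_le_imp_deg_le_strict_upper)
  then show "deg_le 3 m A B"
    using dA(2) dB(1) deg_le_trans[OF A] by blast
qed

end
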